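(* Let $(M,\omega)$ be a compact quantizable Kähler manifold of complex dimension $n$ with very ample quantum line bundle, let $\star$ be its Berezin-Toeplitz star product, and let $\operatorname{Tr}:C^\infty(M)[[\nu]]\to\nu^{-n}\mathbb{C}[[\nu]]$ be the $\mathbb{C}[[\nu]]$-linear map obtained from the asymptotic expansion of the traces of the Berezin-Toeplitz operators (as defined in the context). Then $\operatorname{Tr}$ is a trace, i.e. $$\operatorname{Tr}(f\star g)=\operatorname{Tr}(g\star f)\qquad\text{for all } f,g\in C^\infty(M)[[\nu]].$$
   Context: $\mathbb{N}=\{1,2,3,\dots\}$. $(M,\omega)$ is a compact complex Kähler manifold of complex dimension $n$; $C^\infty(M)$ is the algebra of complex-valued smooth functions. Hamiltonian vector fields and Poisson bracket: $\omega(X_f,\cdot)=df(\cdot)$, $\{f,g\}:=\omega(X_f,X_g)$. $(M,\omega)$ is quantizable if there is a quantum line bundle $(L,h,\nabla)$: a holomorphic line bundle $L$ with Hermitian metric $h$ and connection $\nabla$ compatible with $h$ and with the complex structure, with curvature $\nabla_X\nabla_Y-\nabla_Y\nabla_X-\nabla_{[X,Y]}=-\mathrm{i}\,\omega(X,Y)$. Standing assumption: such a bundle is fixed and $L$ is very ample. For $m\in\mathbb{N}$, $L^m=L^{\otimes m}$ carries the induced metric $h^{(m)}$. The Liouville volume form is $\Omega=\frac1{n!}\omega^n$, and sections of $L^m$ have scalar product $\langle\varphi,\psi\rangle=\int_M h^{(m)}(\varphi,\psi)\,\Omega$ (conjugate-linear in the first argument). $\Pi^{(m)}:\mathrm{L}^2(M,L^m)\to\Gamma_{hol}(M,L^m)$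 is the orthogonal projection onto the finite-dimensional space of holomorphic sections. The Berezin-Toeplitz operator of $f\in C^\infty(M)$ is $T_f^{(m)}:\Gamma_{hol}(M,L^m)\to\Gamma_{hol}(M,L^m)$, $s\mapsto\Pi^{(m)}(fs)$; $\|\cdot\|$ is the operator norm on $\Gamma_{hol}(M,L^m)$. A (formal) star product on $C^\infty(M)$ is an associative $\mathbb{C}[[\nu]]$-bilinear product $\star$ on $C^\infty(M)[[\nu]]$ of the form $f\star g=\sum_{j\ge0}C_j(f,g)\nu^j$ for $f,g\in C^\infty(M)$, with $\mathbb{C}$-bilinear maps $C_j:C^\infty(M)\times C^\infty(M)\to C^\infty(M)$ (extended to formal power series by $(\sum_k\nu^k f_k)\star(\sum_l\nu^l g_l)=\sum_{j,k,l}\nu^{j+k+l}C_j(f_k,g_l)$), satisfying $C_0(f,g)=f\cdot g$ and $C_1(f,g)-C_1(g,f)=-\mathrm{i}\{f,g\}$. The Berezin-Toeplitz star product is the unique star product $f\star g=\sum_{j\ge0}\nu^jC_j(f,g)$ such that for all $f,g\in C^\infty(M)$ and $N\in\mathbb{N}$ there is a constant $K_N(f,g)$ with $\|T_f^{(m)}T_g^{(m)}-\sum_{0\le j<N}m^{-j}T^{(m)}_{C_j(f,g)}\|\le K_N(f,g)\,m^{-N}$ for all $m\in\mathbb{N}$ (its existence and uniqueness are known). Let $\operatorname{Tr}^{(m)}$ be the trace on $\mathrm{End}(\Gamma_{hol}(M,L^m))$. For every $f\in C^\infty(M)$ there is (known fact) a complete asymptotic expansion as $m\to\infty$ $$\operatorname{Tr}^{(m)}(T_f^{(m)})\sim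 m^n\sum_{j=0}^\infty m^{-j}\tau_j(f),\qquad \tau_j(f)\in\mathbb{C},$$ meaning that for each $N$ the difference of $\operatorname{Tr}^{(m)}(T_f^{(m)})$ and $m^n\sum_{0\le j<N}m^{-j}\tau_j(f)$ is $O(m^{n-N})$. The map $\operatorname{Tr}$ is defined for $f\in C^\infty(M)$ by $\operatorname{Tr} f:=\nu^{-n}\sum_{j=0}^\infty\nu^j\tau_j(f)$ and extended $\mathbb{C}[[\nu]]$-linearly: $\operatorname{Tr}\big(\sum_k\nu^kf_k\big)=\nu^{-n}\sum_{j,k}\nu^{j+k}\tau_j(f_k)$. *)

theory Defs
  imports
    "HOL-Analysis.Analysis"
    "HOL-Library.Function_Algebras"
    "HOL-Library.Landau_Symbols"
    "HOL-Computational_Algebra.Formal_Laurent_Series"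
begin

text \<open>
  The manifold \<open>M\<close> is the whole of a Hausdorff type \<open>'a\<close>; compactness is the separate assumption
  \<open>compact (UNIV :: 'a set)\<close>. The complex dimension is \<open>n = CARD('n)\<close>. Functions,
  tangent vectors and sections are added and multiplied pointwise (\<open>Function_Algebras\<close>).
\<close>

section \<open>Calculus on open subsets of complex Euclidean space\<close>

text \<open>Real differentiability of class \<open>C\<^sup>k\<close>; meant for open \<open>S\<close> only.\<close>

primrec Ck_on :: "nat \<Rightarrow> 'v set \<Rightarrow> ('v::real_normed_vector \<Rightarrow> 'w::real_normed_vector) \<Rightarrow> bool" where
  "Ck_on 0 S f \<longleftrightarrow> continuous_on S f"
| "Ck_on (Suc k) S f \<longleftrightarrow>
     (\<forall>x\<in>S. f differentiable (at x)) \<and> (\<forall>v. Ck_on k S (\<lambda>x. frechet_derivative f (at x) v))"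

definition Cinf_on :: "'v set \<Rightarrow> ('v::real_normed_vector \<Rightarrow> 'w::real_normed_vector) \<Rightarrow> bool" where
  "Cinf_on S f \<longleftrightarrow> (\<forall>k. Ck_on k S f)"

text \<open>Holomorphy in several variables: the real derivative exists and is complex linear.\<close>

definition hol_on :: "(complex ^ 'n) set \<Rightarrow> (complex ^ 'n \<Rightarrow> complex) \<Rightarrow> bool" where
  "hol_on S f \<longleftrightarrow>
     (\<forall>z\<in>S. \<exists>D. (f has_derivative D) (at z) \<and> (\<forall>c w. D (c *s w) = c * D w))"

section \<open>Complex manifolds\<close>

text \<open>A chart is a pair of its domain and its coordinate map.\<close>

type_synonym ('a, 'n) chart = "'a set \<times> ('a \<Rightarrow> complex ^ 'n)"

definition chart_inv :: "('a, 'n) chart \<Rightarrow> complex ^ 'n \<Rightarrow> 'a" where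
  "chart_inv c = inv_into (fst c) (snd c)"

definition complex_atlas :: "('a::t2_space, 'n::finite) chart set \<Rightarrow> bool" where
  "complex_atlas A \<longleftrightarrow>
     (\<Union>c\<in>A. fst c) = UNIV \<and>
     (\<forall>c\<in>A. open (fst c) \<and> open (snd c ` fst c) \<and>
            homeomorphism (fst c) (snd c ` fst c) (snd c) (chart_inv c)) \<and>
     (\<forall>c\<in>A. \<forall>d\<in>A. \<forall>j. hol_on (snd d ` (fst c \<inter> fst d)) (\<lambda>z. snd c (chart_inv d z) $ j))"

definition smooth_on_mfd ::
  "('a::t2_space, 'n::finite) chart set \<Rightarrow> 'a set \<Rightarrow> ('a \<Rightarrow> complex) \<Rightarrow> bool" where
  "smooth_on_mfd A V f \<longleftrightarrow> (\<forall>c\<in>A. Cinf_on (snd c ` (fst c \<inter> V)) (f \<circ> chart_inv c))"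

definition hol_on_mfd ::
  "('a::t2_space, 'n::finite) chart set \<Rightarrow> 'a set \<Rightarrow> ('a \<Rightarrow> complex) \<Rightarrow> bool" where
  "hol_on_mfd A V f \<longleftrightarrow> (\<forall>c\<in>A. hol_on (snd c ` (fst c \<inter> V)) (f \<circ> chart_inv c))"

definition smooth_fun :: "('a::t2_space, 'n::finite) chart set \<Rightarrow> ('a \<Rightarrow> complex) set" where
  "smooth_fun A = {f. smooth_on_mfd A UNIV f}"

section \<open>Tangent vectors and vector fields\<close>

type_synonym 'a tvec = "('a \<Rightarrow> complex) \<Rightarrow> complex"

text \<open>
  The complexified tangent space at \<open>p\<close>: complex derivations at \<open>p\<close> of \<open>C\<^sup>\<infinity>(M)\<close>, set to
  \<open>0\<close> on non-smooth functions so that equality of tangent vectors is equality in HOL.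
\<close>

definition tangent :: "('a::t2_space, 'n::finite) chart set \<Rightarrow> 'a \<Rightarrow> 'a tvec set" where
  "tangent A p = {v.
     (\<forall>f. f \<notin> smooth_fun A \<longrightarrow> v f = 0) \<and>
     (\<forall>f\<in>smooth_fun A. \<forall>g\<in>smooth_fun A.
        v (f + g) = v f + v g \<and> v (f * g) = v f * g p + f p * v g) \<and>
     (\<forall>f\<in>smooth_fun A. \<forall>c. v (\<lambda>q. c * f q) = c * v f)}"

text \<open>
  The real tangent vector at \<open>p\<close> which the chart \<open>c\<close> identifies with
  \<open>w \<in> \<complex>\<^sup>n = \<real>\<^sup>2\<^sup>n\<close>. With \<open>z\<^sub>j = x\<^sub>j + \<i> y\<^sub>j\<close>, the vectors
  \<open>\<partial>/\<partial>x\<^sub>j\<close> and \<open>\<partial>/\<partial>y\<^sub>j\<close> are the cases \<open>w = axis j 1\<close> and \<open>w = axis j \<i>\<close>,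
  and the complex structure \<open>J\<close> maps \<open>coord_vec A c p w\<close> to \<open>coord_vec A c p (\<i> *s w)\<close>.
\<close>

definition coord_vec ::
  "('a::t2_space, 'n::finite) chart set \<Rightarrow> ('a, 'n) chart \<Rightarrow> 'a \<Rightarrow> complex ^ 'n \<Rightarrow> 'a tvec" where
  "coord_vec A c p w =
     (\<lambda>f. if f \<in> smooth_fun A then frechet_derivative (f \<circ> chart_inv c) (at (snd c p)) w else 0)"

text \<open>Tangent vectors of type \<open>(0,1)\<close>: those of the form \<open>v + \<i> J v\<close> with \<open>v\<close> real.\<close>

definition tangent01 :: "('a::t2_space, 'n::finite) chart set \<Rightarrow> 'a \<Rightarrow> 'a tvec set" where
  "tangent01 A p =
     {(\<lambda>f. coord_vec A c p w f + \<i> * coord_vec A c p (\<i> *s w) f) | c w. c \<in> A \<and> p \<in> fst c}"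

type_synonym 'a vfield = "'a \<Rightarrow> 'a tvec"

definition vapply :: "'a vfield \<Rightarrow> ('a \<Rightarrow> complex) \<Rightarrow> 'a \<Rightarrow> complex" where
  "vapply X f = (\<lambda>p. X p f)"

definition vfields :: "('a::t2_space, 'n::finite) chart set \<Rightarrow> 'a vfield set" where
  "vfields A = {X. (\<forall>p. X p \<in> tangent A p) \<and> (\<forall>f\<in>smooth_fun A. vapply X f \<in> smooth_fun A)}"

definition real_vfield :: "('a::t2_space, 'n::finite) chart set \<Rightarrow> 'a vfield \<Rightarrow> bool" where
  "real_vfield A X \<longleftrightarrow>
     X \<in> vfields A \<and> (\<forall>f\<in>smooth_fun A. \<forall>p. X p (cnj \<circ> f) = cnj (X p f))"

definition lie_bracket ::
  "('a::t2_space, 'n::finite) chart set \<Rightarrow> 'a vfield \<Rightarrow> 'a vfield \<Rightarrow> 'a vfield" where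
  "lie_bracket A X Y =
     (\<lambda>p f. if f \<in> smooth_fun A then X p (vapply Y f) - Y p (vapply X f) else 0)"

section \<open>Kaehler forms, Hamiltonian vector fields, Poisson bracket\<close>

text \<open>Two-forms are extended complex bilinearly to the complexified tangent spaces.\<close>

type_synonym 'a form2 = "'a \<Rightarrow> 'a tvec \<Rightarrow> 'a tvec \<Rightarrow> complex"

definition form_apply :: "'a form2 \<Rightarrow> 'a vfield \<Rightarrow> 'a vfield \<Rightarrow> 'a \<Rightarrow> complex" where
  "form_apply \<omega> X Y = (\<lambda>p. \<omega> p (X p) (Y p))"

definition smooth_form2 :: "('a::t2_space, 'n::finite) chart set \<Rightarrow> 'a form2 \<Rightarrow> bool" where
  "smooth_form2 A \<omega> \<longleftrightarrow>
     (\<forall>p. \<forall>u\<in>tangent A p. \<forall>v\<in>tangent A p. \<forall>w\<in>tangent A p. \<forall>a b.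
        \<omega> p (\<lambda>f. a * u f + b * v f) w = a * \<omega> p u w + b * \<omega> p v w \<and>
        \<omega> p u v = - \<omega> p v u) \<and>
     (\<forall>c\<in>A. \<forall>w w'. smooth_on_mfd A (fst c) (\<lambda>p. \<omega> p (coord_vec A c p w) (coord_vec A c p w')))"

text \<open>Closedness \<open>d\<omega> = 0\<close>, by the invariant formula for the exterior derivative.\<close>

definition closed_form2 :: "('a::t2_space, 'n::finite) chart set \<Rightarrow> 'a form2 \<Rightarrow> bool" where
  "closed_form2 A \<omega> \<longleftrightarrow>
     (\<forall>X\<in>vfields A. \<forall>Y\<in>vfields A. \<forall>Z\<in>vfields A.
        vapply X (form_apply \<omega> Y Z) + vapply Y (form_apply \<omega> Z X) + vapply Z (form_apply \<omega> X Y)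
        - form_apply \<omega> (lie_bracket A X Y) Z - form_apply \<omega> (lie_bracket A Y Z) X
        - form_apply \<omega> (lie_bracket A Z X) Y = 0)"

text \<open>
  A closed real form with \<open>\<omega>(J v, J w) = \<omega>(v, w)\<close> and \<open>\<omega>(v, J v) > 0\<close> for \<open>v \<noteq> 0\<close>; the
  latter contains nondegeneracy.
\<close>

definition kaehler_form :: "('a::t2_space, 'n::finite) chart set \<Rightarrow> 'a form2 \<Rightarrow> bool" where
  "kaehler_form A \<omega> \<longleftrightarrow>
     smooth_form2 A \<omega> \<and> closed_form2 A \<omega> \<and>
     (\<forall>c\<in>A. \<forall>p\<in>fst c. \<forall>w w'.
        \<omega> p (coord_vec A c p w) (coord_vec A c p w') \<in> \<real> \<and>
        \<omega> p (coord_vec A c p (\<i> *s w)) (coord_vec A c p (\<i> *s w')) =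
          \<omega> p (coord_vec A c p w) (coord_vec A c p w')) \<and>
     (\<forall>c\<in>A. \<forall>p\<in>fst c. \<forall>w. w \<noteq> 0 \<longrightarrow>
        Re (\<omega> p (coord_vec A c p w) (coord_vec A c p (\<i> *s w))) > 0)"

definition hamiltonian_vfield ::
  "('a::t2_space, 'n::finite) chart set \<Rightarrow> 'a form2 \<Rightarrow> ('a \<Rightarrow> complex) \<Rightarrow> 'a vfield" where
  "hamiltonian_vfield A \<omega> f =
     (THE X. X \<in> vfields A \<and> (\<forall>p. \<forall>v\<in>tangent A p. \<omega> p (X p) v = v f))"

definition poisson ::
  "('a::t2_space, 'n::finite) chart set \<Rightarrow> 'a form2 \<Rightarrow> ('a \<Rightarrow> complex) \<Rightarrow> ('a \<Rightarrow> complex) \<Rightarrow>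
     'a \<Rightarrow> complex" where
  "poisson A \<omega> f g = form_apply \<omega> (hamiltonian_vfield A \<omega> f) (hamiltonian_vfield A \<omega> g)"

section \<open>Integration against the Liouville volume form\<close>

text \<open>
  The value of \<open>\<Omega> = \<omega>\<^sup>n / n!\<close> on
  \<open>(\<partial>/\<partial>x\<^sub>1, \<partial>/\<partial>y\<^sub>1, \<dots>, \<partial>/\<partial>x\<^sub>n, \<partial>/\<partial>y\<^sub>n)\<close>, that is, its density with respect to Lebesgue
  measure in a chart. For a two-form,
  \<open>\<omega>\<^sup>n(v\<^sub>1, \<dots>, v\<^sub>2\<^sub>n) = 2\<^sup>-\<^sup>n \<Sum>\<^sub>\<sigma> sign \<sigma> \<Prod>\<^sub>j \<omega>(v\<^sub>\<sigma>\<^sub>(\<^sub>2\<^sub>j\<^sub>-\<^sub>1\<^sub>), v\<^sub>\<sigma>\<^sub>(\<^sub>2\<^sub>j\<^sub>)\<close>); the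
  index \<open>2j - 1\<close> is encoded as \<open>(j, False)\<close> and \<open>2j\<close> as \<open>(j, True)\<close>. No ordering
  of \<open>'n\<close> is needed since permuting the pairs is even.
\<close>

definition real_frame :: "'n::finite \<times> bool \<Rightarrow> complex ^ 'n" where
  "real_frame a = axis (fst a) (if snd a then \<i> else 1)"

definition liouville_density ::
  "('a::t2_space, 'n::finite) chart set \<Rightarrow> 'a form2 \<Rightarrow> ('a, 'n) chart \<Rightarrow> 'a \<Rightarrow> complex" where
  "liouville_density A \<omega> c p =
     (\<Sum>\<sigma> | \<sigma> permutes (UNIV :: ('n \<times> bool) set).
        of_int (sign \<sigma>) *
        (\<Prod>j\<in>UNIV. \<omega> p (coord_vec A c p (real_frame (\<sigma> (j, False))))
                      (coord_vec A c p (real_frame (\<sigma> (j, True))))))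
     / (2 ^ CARD('n) * fact CARD('n))"

definition chart_partition ::
  "('a::t2_space, 'n::finite) chart set \<Rightarrow> nat \<Rightarrow> (nat \<Rightarrow> ('a, 'n) chart) \<Rightarrow> (nat \<Rightarrow> 'a \<Rightarrow> real) \<Rightarrow>
     bool" where
  "chart_partition A k c \<rho> \<longleftrightarrow>
     (\<forall>l<k. c l \<in> A \<and> continuous_on UNIV (\<rho> l) \<and> (\<forall>p. 0 \<le> \<rho> l p) \<and>
        (\<exists>K. compact K \<and> K \<subseteq> fst (c l) \<and> (\<forall>p. p \<notin> K \<longrightarrow> \<rho> l p = 0))) \<and>
     (\<forall>p. (\<Sum>l<k. \<rho> l p) = 1)"

text \<open>
  \<open>\<integral>\<^sub>M f \<Omega>\<close>, by means of a partition of unity subordinate to finitely many charts; by the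
  change of variables formula the value does not depend on the one that is chosen.
\<close>

definition liouville_integral ::
  "('a::t2_space, 'n::finite) chart set \<Rightarrow> 'a form2 \<Rightarrow> ('a \<Rightarrow> complex) \<Rightarrow> complex" where
  "liouville_integral A \<omega> f =
     (let (k, c, \<rho>) = (SOME (k, c, \<rho>). chart_partition A k c \<rho>)
      in \<Sum>l<k. LINT z : snd (c l) ` fst (c l) | lborel.
           (let p = chart_inv (c l) z
            in of_real (\<rho> l p) * f p * liouville_density A \<omega> (c l) p))"

section \<open>Line bundles and their sections\<close>

text \<open>
  A line bundle is presented by local frames \<open>e\<^sub>i\<close> over an open cover \<open>patch L i\<close> and transition
  functions \<open>g\<^sub>i\<^sub>j\<close> with \<open>e\<^sub>j = g\<^sub>i\<^sub>j e\<^sub>i\<close>. A section is the family of its components \<open>s\<^sub>i\<close>,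
  where \<open>s = s\<^sub>i e\<^sub>i\<close> on \<open>patch L i\<close>, so \<open>s\<^sub>i = g\<^sub>i\<^sub>j s\<^sub>j\<close>; components are set to \<open>0\<close> outside
  their patch.
\<close>

record ('i, 'a) line_bundle =
  patch :: "'i \<Rightarrow> 'a set"
  transition :: "'i \<Rightarrow> 'i \<Rightarrow> 'a \<Rightarrow> complex"

type_synonym ('i, 'a) bsection = "'i \<Rightarrow> 'a \<Rightarrow> complex"

definition holomorphic_line_bundle ::
  "('a::t2_space, 'n::finite) chart set \<Rightarrow> ('i, 'a) line_bundle \<Rightarrow> bool" where
  "holomorphic_line_bundle A L \<longleftrightarrow>
     (\<forall>i. open (patch L i)) \<and> (\<Union>i. patch L i) = UNIV \<and>
     (\<forall>i j. hol_on_mfd A (patch L i \<inter> patch L j) (transition L i j)) \<and>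
     (\<forall>i j. \<forall>p\<in>patch L i \<inter> patch L j. transition L i j p \<noteq> 0) \<and>
     (\<forall>i. \<forall>p\<in>patch L i. transition L i i p = 1) \<and>
     (\<forall>i j k. \<forall>p\<in>patch L i \<inter> patch L j \<inter> patch L k.
        transition L i j p * transition L j k p = transition L i k p)"

definition tensor_power :: "('i, 'a) line_bundle \<Rightarrow> nat \<Rightarrow> ('i, 'a) line_bundle" where
  "tensor_power L m = \<lparr>patch = patch L, transition = (\<lambda>i j p. transition L i j p ^ m)\<rparr>"

definition sections :: "('i, 'a) line_bundle \<Rightarrow> ('i, 'a) bsection set" where
  "sections L = {s.
     (\<forall>i p. p \<notin> patch L i \<longrightarrow> s i p = 0) \<and>
     (\<forall>i j. \<forall>p\<in>patch L i \<inter> patch L j. s i p = transition L i j p * s j p)}"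

definition smooth_sections ::
  "('a::t2_space, 'n::finite) chart set \<Rightarrow> ('i, 'a) line_bundle \<Rightarrow> ('i, 'a) bsection set" where
  "smooth_sections A L = {s \<in> sections L. \<forall>i. smooth_on_mfd A (patch L i) (s i)}"

definition hol_sections ::
  "('a::t2_space, 'n::finite) chart set \<Rightarrow> ('i, 'a) line_bundle \<Rightarrow> ('i, 'a) bsection set" where
  "hol_sections A L = {s \<in> sections L. \<forall>i. hol_on_mfd A (patch L i) (s i)}"

definition sec_scale :: "complex \<Rightarrow> ('i, 'a) bsection \<Rightarrow> ('i, 'a) bsection" where
  "sec_scale a s = (\<lambda>i p. a * s i p)"

definition fun_scale :: "('a \<Rightarrow> complex) \<Rightarrow> ('i, 'a) bsection \<Rightarrow> ('i, 'a) bsection" where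
  "fun_scale f s = (\<lambda>i p. f p * s i p)"

interpretation sec: vector_space "sec_scale :: complex \<Rightarrow> ('i, 'a) bsection \<Rightarrow> ('i, 'a) bsection"
  by unfold_locales (auto simp: sec_scale_def fun_eq_iff algebra_simps)

section \<open>Quantum line bundles\<close>

text \<open>A Hermitian metric is given by the local weights \<open>h\<^sub>i = h(e\<^sub>i, e\<^sub>i)\<close>.\<close>

type_synonym ('i, 'a) metric = "'i \<Rightarrow> 'a \<Rightarrow> real"

definition hermitian_metric ::
  "('a::t2_space, 'n::finite) chart set \<Rightarrow> ('i, 'a) line_bundle \<Rightarrow> ('i, 'a) metric \<Rightarrow> bool" where
  "hermitian_metric A L h \<longleftrightarrow>
     (\<forall>i. smooth_on_mfd A (patch L i) (\<lambda>p. of_real (h i p))) \<and>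
     (\<forall>i. \<forall>p\<in>patch L i. h i p > 0) \<and>
     (\<forall>i j. \<forall>p\<in>patch L i \<inter> patch L j. h j p = h i p * (cmod (transition L i j p))\<^sup>2)"

definition metric_power :: "('i, 'a) metric \<Rightarrow> nat \<Rightarrow> ('i, 'a) metric" where
  "metric_power h m = (\<lambda>i p. h i p ^ m)"

text \<open>The function \<open>h(s, t)\<close>, conjugate linear in \<open>s\<close>; any frame around \<open>p\<close> gives the same value.\<close>

definition herm ::
  "('i, 'a) line_bundle \<Rightarrow> ('i, 'a) metric \<Rightarrow> ('i, 'a) bsection \<Rightarrow> ('i, 'a) bsection \<Rightarrow> 'a \<Rightarrow> complex" where
  "herm L h s t p =
     (let i = (SOME i. p \<in> patch L i) in of_real (h i p) * cnj (s i p) * t i p)"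

type_synonym ('i, 'a) conn = "'a vfield \<Rightarrow> ('i, 'a) bsection \<Rightarrow> ('i, 'a) bsection"

definition connection ::
  "('a::t2_space, 'n::finite) chart set \<Rightarrow> ('i, 'a) line_bundle \<Rightarrow> ('i, 'a) conn \<Rightarrow> bool" where
  "connection A L nab \<longleftrightarrow>
     (\<forall>X\<in>vfields A. \<forall>s\<in>smooth_sections A L. nab X s \<in> smooth_sections A L) \<and>
     (\<forall>X\<in>vfields A. \<forall>Y\<in>vfields A. \<forall>f\<in>smooth_fun A. \<forall>g\<in>smooth_fun A. \<forall>s\<in>smooth_sections A L.
        nab (\<lambda>p u. f p * X p u + g p * Y p u) s = fun_scale f (nab X s) + fun_scale g (nab Y s)) \<and>
     (\<forall>X\<in>vfields A. \<forall>s\<in>smooth_sections A L. \<forall>t\<in>smooth_sections A L.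
        nab X (s + t) = nab X s + nab X t) \<and>
     (\<forall>X\<in>vfields A. \<forall>f\<in>smooth_fun A. \<forall>s\<in>smooth_sections A L.
        nab X (fun_scale f s) = fun_scale (vapply X f) s + fun_scale f (nab X s))"

definition metric_compatible ::
  "('a::t2_space, 'n::finite) chart set \<Rightarrow> ('i, 'a) line_bundle \<Rightarrow> ('i, 'a) metric \<Rightarrow> ('i, 'a) conn \<Rightarrow>
     bool" where
  "metric_compatible A L h nab \<longleftrightarrow>
     (\<forall>X. real_vfield A X \<longrightarrow> (\<forall>s\<in>smooth_sections A L. \<forall>t\<in>smooth_sections A L.
        vapply X (herm L h s t) = herm L h (nab X s) t + herm L h s (nab X t)))"

text \<open>
  The \<open>(0,1)\<close>-part of the connection is the Cauchy-Riemann operator of \<open>L\<close>: it kills local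
  holomorphic sections (near any point these extend to global smooth sections).
\<close>

definition complex_compatible ::
  "('a::t2_space, 'n::finite) chart set \<Rightarrow> ('i, 'a) line_bundle \<Rightarrow> ('i, 'a) conn \<Rightarrow> bool" where
  "complex_compatible A L nab \<longleftrightarrow>
     (\<forall>X\<in>vfields A. \<forall>s\<in>smooth_sections A L. \<forall>V. open V \<longrightarrow>
        (\<forall>i. hol_on_mfd A (V \<inter> patch L i) (s i)) \<longrightarrow>
        (\<forall>p\<in>V. X p \<in> tangent01 A p \<longrightarrow> (\<forall>i. nab X s i p = 0)))"

definition quantum_line_bundle ::
  "('a::t2_space, 'n::finite) chart set \<Rightarrow> 'a form2 \<Rightarrow> ('i, 'a) line_bundle \<Rightarrow> ('i, 'a) metric \<Rightarrow>
     ('i, 'a) conn \<Rightarrow> bool" where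
  "quantum_line_bundle A \<omega> L h nab \<longleftrightarrow>
     holomorphic_line_bundle A L \<and> hermitian_metric A L h \<and> connection A L nab \<and>
     metric_compatible A L h nab \<and> complex_compatible A L nab \<and>
     (\<forall>X\<in>vfields A. \<forall>Y\<in>vfields A. \<forall>s\<in>smooth_sections A L.
        nab X (nab Y s) - nab Y (nab X s) - nab (lie_bracket A X Y) s =
          fun_scale (\<lambda>p. - \<i> * form_apply \<omega> X Y p) s)"

text \<open>
  The point \<open>[s\<^sub>0(p) : \<dots> : s\<^sub>N(p)]\<close> of projective space, as the set of its homogeneous coordinate
  vectors (extended by \<open>0\<close> beyond \<open>N\<close>).
\<close>

definition kodaira_map ::
  "('i, 'a) line_bundle \<Rightarrow> nat \<Rightarrow> (nat \<Rightarrow> ('i, 'a) bsection) \<Rightarrow> 'a \<Rightarrow> (nat \<Rightarrow> complex) set" where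
  "kodaira_map L N s p =
     (let i = (SOME i. p \<in> patch L i)
      in {(\<lambda>l. if l \<le> N then a * s l i p else 0) | a. a \<noteq> 0})"

text \<open>
  \<open>L\<close> is very ample: a basis of its global holomorphic sections embeds \<open>M\<close> into projective
  space. The conditions on the map are that it is well defined, injective, and an immersion (in the
  affine coordinates \<open>s\<^sub>l / s\<^sub>k\<close> around a point with \<open>s\<^sub>k(p) \<noteq> 0\<close>), which suffices because
  \<open>M\<close> is compact.
\<close>

definition very_ample ::
  "('a::t2_space, 'n::finite) chart set \<Rightarrow> ('i, 'a) line_bundle \<Rightarrow> bool" where
  "very_ample A L \<longleftrightarrow>
     (\<exists>N s. inj_on s {..N} \<and> sec.independent (s ` {..N}) \<and> sec.span (s ` {..N}) = hol_sections A L \<and>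
        (\<forall>i. \<forall>p\<in>patch L i. \<exists>k\<le>N. s k i p \<noteq> 0) \<and>
        inj (kodaira_map L N s) \<and>
        (\<forall>c\<in>A. \<forall>i. \<forall>p\<in>fst c \<inter> patch L i. \<forall>k\<le>N. s k i p \<noteq> 0 \<longrightarrow>
           (\<forall>w. w \<noteq> 0 \<longrightarrow> (\<exists>l\<le>N.
              frechet_derivative (\<lambda>z. s l i (chart_inv c z) / s k i (chart_inv c z)) (at (snd c p)) w
                \<noteq> 0))))"

section \<open>Berezin-Toeplitz operators\<close>

definition sec_inner ::
  "('a::t2_space, 'n::finite) chart set \<Rightarrow> 'a form2 \<Rightarrow> ('i, 'a) line_bundle \<Rightarrow> ('i, 'a) metric \<Rightarrow>
     ('i, 'a) bsection \<Rightarrow> ('i, 'a) bsection \<Rightarrow> complex" where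
  "sec_inner A \<omega> L h s t = liouville_integral A \<omega> (herm L h s t)"

definition sec_norm ::
  "('a::t2_space, 'n::finite) chart set \<Rightarrow> 'a form2 \<Rightarrow> ('i, 'a) line_bundle \<Rightarrow> ('i, 'a) metric \<Rightarrow>
     ('i, 'a) bsection \<Rightarrow> real" where
  "sec_norm A \<omega> L h s = sqrt (Re (sec_inner A \<omega> L h s s))"

definition hol_proj ::
  "('a::t2_space, 'n::finite) chart set \<Rightarrow> 'a form2 \<Rightarrow> ('i, 'a) line_bundle \<Rightarrow> ('i, 'a) metric \<Rightarrow>
     ('i, 'a) bsection \<Rightarrow> ('i, 'a) bsection" where
  "hol_proj A \<omega> L h s =
     (THE t. t \<in> hol_sections A L \<and> (\<forall>u\<in>hol_sections A L. sec_inner A \<omega> L h u (s - t) = 0))"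

text \<open>\<open>T\<^sub>f\<^sup>(\<^sup>m\<^sup>)\<close>; only its values on holomorphic sections of \<open>L\<^sup>m\<close> are meaningful.\<close>

definition toeplitz ::
  "('a::t2_space, 'n::finite) chart set \<Rightarrow> 'a form2 \<Rightarrow> ('i, 'a) line_bundle \<Rightarrow> ('i, 'a) metric \<Rightarrow>
     nat \<Rightarrow> ('a \<Rightarrow> complex) \<Rightarrow> ('i, 'a) bsection \<Rightarrow> ('i, 'a) bsection" where
  "toeplitz A \<omega> L h m f s =
     hol_proj A \<omega> (tensor_power L m) (metric_power h m) (fun_scale f s)"

definition op_norm ::
  "('a::t2_space, 'n::finite) chart set \<Rightarrow> 'a form2 \<Rightarrow> ('i, 'a) line_bundle \<Rightarrow> ('i, 'a) metric \<Rightarrow>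
     nat \<Rightarrow> (('i, 'a) bsection \<Rightarrow> ('i, 'a) bsection) \<Rightarrow> real" where
  "op_norm A \<omega> L h m T =
     (SUP s \<in> {s \<in> hol_sections A (tensor_power L m).
                sec_norm A \<omega> (tensor_power L m) (metric_power h m) s \<le> 1}.
        sec_norm A \<omega> (tensor_power L m) (metric_power h m) (T s))"

text \<open>For an endomorphism \<open>T\<close> of a finite-dimensional \<open>W\<close>, every basis gives the same value.\<close>

definition op_trace ::
  "('i, 'a) bsection set \<Rightarrow> (('i, 'a) bsection \<Rightarrow> ('i, 'a) bsection) \<Rightarrow> complex" where
  "op_trace W T =
     (let B = (SOME B. sec.independent B \<and> sec.span B = W) in \<Sum>b\<in>B. sec.representation B (T b) b)"

section \<open>Star products and the formal trace\<close>

definition smooth_series :: "('a::t2_space, 'n::finite) chart set \<Rightarrow> ('a \<Rightarrow> complex) fps set" where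
  "smooth_series A = {F. \<forall>k. fps_nth F k \<in> smooth_fun A}"

type_synonym 'a cochains = "nat \<Rightarrow> ('a \<Rightarrow> complex) \<Rightarrow> ('a \<Rightarrow> complex) \<Rightarrow> ('a \<Rightarrow> complex)"

definition star :: "'a cochains \<Rightarrow> ('a \<Rightarrow> complex) fps \<Rightarrow> ('a \<Rightarrow> complex) fps \<Rightarrow> ('a \<Rightarrow> complex) fps" where
  "star C F G =
     Abs_fps (\<lambda>r. \<Sum>(j, k, l) \<in> {(j, k, l). j + k + l = r}. C j (fps_nth F k) (fps_nth G l))"

definition star_product ::
  "('a::t2_space, 'n::finite) chart set \<Rightarrow> 'a form2 \<Rightarrow> 'a cochains \<Rightarrow> bool" where
  "star_product A \<omega> C \<longleftrightarrow>
     (\<forall>j. \<forall>f\<in>smooth_fun A. \<forall>g\<in>smooth_fun A. C j f g \<in> smooth_fun A) \<and>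
     (\<forall>j. \<forall>f\<in>smooth_fun A. \<forall>f'\<in>smooth_fun A. \<forall>g\<in>smooth_fun A. \<forall>a b.
        C j (\<lambda>p. a * f p + b * f' p) g = (\<lambda>p. a * C j f g p + b * C j f' g p) \<and>
        C j g (\<lambda>p. a * f p + b * f' p) = (\<lambda>p. a * C j g f p + b * C j g f' p)) \<and>
     (\<forall>F\<in>smooth_series A. \<forall>G\<in>smooth_series A. \<forall>H\<in>smooth_series A.
        star C (star C F G) H = star C F (star C G H)) \<and>
     (\<forall>f\<in>smooth_fun A. \<forall>g\<in>smooth_fun A. C 0 f g = f * g) \<and>
     (\<forall>f\<in>smooth_fun A. \<forall>g\<in>smooth_fun A.
        C 1 f g - C 1 g f = (\<lambda>p. - \<i> * poisson A \<omega> f g p))"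

definition berezin_toeplitz_star_product ::
  "('a::t2_space, 'n::finite) chart set \<Rightarrow> 'a form2 \<Rightarrow> ('i, 'a) line_bundle \<Rightarrow> ('i, 'a) metric \<Rightarrow>
     'a cochains \<Rightarrow> bool" where
  "berezin_toeplitz_star_product A \<omega> L h C \<longleftrightarrow>
     star_product A \<omega> C \<and>
     (\<forall>f\<in>smooth_fun A. \<forall>g\<in>smooth_fun A. \<forall>N\<ge>1. \<exists>K. \<forall>m\<ge>1.
        op_norm A \<omega> L h m
          (\<lambda>s. toeplitz A \<omega> L h m f (toeplitz A \<omega> L h m g s)
               - (\<Sum>j<N. sec_scale (1 / of_nat m ^ j) (toeplitz A \<omega> L h m (C j f g) s)))
        \<le> K / real m ^ N)"

text \<open>\<open>\<tau> j f\<close> are the coefficients of the complete asymptotic expansion of \<open>Tr T\<^sub>f\<^sup>(\<^sup>m\<^sup>)\<close>.\<close>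

definition trace_coefficients ::
  "('a::t2_space, 'n::finite) chart set \<Rightarrow> 'a form2 \<Rightarrow> ('i, 'a) line_bundle \<Rightarrow> ('i, 'a) metric \<Rightarrow>
     (nat \<Rightarrow> ('a \<Rightarrow> complex) \<Rightarrow> complex) \<Rightarrow> bool" where
  "trace_coefficients A \<omega> L h \<tau> \<longleftrightarrow>
     (\<forall>f\<in>smooth_fun A. \<forall>N\<ge>1.
        (\<lambda>m. op_trace (hol_sections A (tensor_power L m)) (toeplitz A \<omega> L h m f)
              - of_nat m ^ CARD('n) * (\<Sum>j<N. \<tau> j f / of_nat m ^ j))
        \<in> O(\<lambda>m. of_nat m powi (int CARD('n) - int N)))"

text \<open>\<open>Tr F = \<nu>\<^sup>-\<^sup>n \<Sum>\<^sub>j\<^sub>,\<^sub>k \<nu>\<^sup>j\<^sup>+\<^sup>k \<tau>\<^sub>j(F\<^sub>k)\<close> as a formal Laurent series in \<open>\<nu>\<close>.\<close>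

definition formal_trace ::
  "nat \<Rightarrow> (nat \<Rightarrow> ('a \<Rightarrow> complex) \<Rightarrow> complex) \<Rightarrow> ('a \<Rightarrow> complex) fps \<Rightarrow> complex fls" where
  "formal_trace n \<tau> F =
     fls_X_intpow (- int n) * fps_to_fls (Abs_fps (\<lambda>r. \<Sum>k\<le>r. \<tau> (r - k) (fps_nth F k)))"

end

theory Submission
  imports Defs
begin

text \<open>
  Ordinary traces commute, so the defining estimate of the Berezin-Toeplitz star product, applied to
  \<open>T\<^sub>f T\<^sub>g\<close> and to \<open>T\<^sub>g T\<^sub>f\<close>, bounds \<open>\<Sum>\<^sub>j\<^sub><\<^sub>N m\<^sup>-\<^sup>j Tr (T(C\<^sub>j(f,g)) - T(C\<^sub>j(g,f)))\<close> by
  \<open>K m\<^sup>-\<^sup>N dim \<Gamma>\<^sub>h\<^sub>o\<^sub>l(M, L\<^sup>m)\<close>. The dimension is \<open>Tr T\<^sub>1 = O(m\<^sup>n)\<close>, so inserting the asymptotic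
  expansions of the traces and comparing powers of \<open>m\<close> gives
  \<open>\<Sum>\<^sub>i\<^sub>+\<^sub>j\<^sub>=\<^sub>r \<tau>\<^sub>i(C\<^sub>j(f,g)) = \<Sum>\<^sub>i\<^sub>+\<^sub>j\<^sub>=\<^sub>r \<tau>\<^sub>i(C\<^sub>j(g,f))\<close> for every \<open>r\<close>.

  For the trace estimate, \<open>\<langle>\<cdot>,\<cdot>\<rangle>\<close> must be positive definite on continuous sections. This rests on
  the positivity of the Liouville density, a Pfaffian, which is computed by orthogonalizing the
  coordinate frame: the Pfaffian is alternating and multilinear, so it does not change, and in an
  orthogonal frame all of its terms are nonnegative.
\<close>

section \<open>Finite-dimensional Hermitian spaces\<close>

text \<open>Multiplication by \<open>f\<close> leaves the holomorphic sections, so the scalar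
  product is needed on a larger space. The continuous sections serve: they contain
  \<open>f s\<close>, and a nonzero one is nonzero on an open set, where a positive density makes
  its norm positive. This ambient space \<open>V\<close> may have infinite dimension;
  finite-dimensional subspaces enter as spans of finite orthonormal sets, and the projection is a
  finite sum over such a set. The operator norm is a supremum of reals, so an estimate for it says
  something about single vectors only once the supremum is known to be over a bounded set; finite
  dimension supplies this. The factor \<open>m^n\<close> lost to the dimension is harmless: the
  trace expansions themselves have error \<open>m^(n-N)\<close>, so both errors have the same order
  and \<open>m^n\<close> cancels. As \<open>N\<close> is arbitrary, every coefficient is reached.
  The coefficients \<tau> are known only through the expansions, so even their additivity has to be
  read off from uniqueness of expansions; after that, the passage from functions to power series is
  a rearrangement of finite sums.\<close>

locale hermitian_space = vector_space scale
  for scale :: "complex \<Rightarrow> 'v::ab_group_add \<Rightarrow> 'v" +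
  fixes V :: "'v set" and ip :: "'v \<Rightarrow> 'v \<Rightarrow> complex"
  assumes subspace_V: "subspace V"
    and ip_add: "\<lbrakk>u \<in> V; s \<in> V; t \<in> V\<rbrakk> \<Longrightarrow> ip u (s + t) = ip u s + ip u t"
    and ip_scale: "\<lbrakk>u \<in> V; s \<in> V\<rbrakk> \<Longrightarrow> ip u (scale a s) = a * ip u s"
    and ip_cnj: "\<lbrakk>u \<in> V; s \<in> V\<rbrakk> \<Longrightarrow> ip s u = cnj (ip u s)"
    and ip_pos: "\<lbrakk>s \<in> V; s \<noteq> 0\<rbrakk> \<Longrightarrow> Re (ip s s) > 0"
begin

text \<open>Finiteness is built in, so \<open>span E\<close> is finite-dimensional although
  \<open>V\<close> need not be.\<close>

definition orthonormal :: "'v set \<Rightarrow> bool" where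
  "orthonormal E \<longleftrightarrow> finite E \<and> E \<subseteq> V \<and> (\<forall>e\<in>E. \<forall>e'\<in>E. ip e e' = (if e = e' then 1 else 0))"

lemma orthonormalD:
  assumes "orthonormal E"
  shows "finite E" "E \<subseteq> V" "\<And>e e'. e \<in> E \<Longrightarrow> e' \<in> E \<Longrightarrow> ip e e' = (if e = e' then 1 else 0)"
  using assms by (auto simp: orthonormal_def)

lemma ip_zero: "u \<in> V \<Longrightarrow> ip u 0 = 0"
  using ip_scale[of u 0 0] subspace_0[OF subspace_V] by simp

lemma ip_diff: "\<lbrakk>u \<in> V; s \<in> V; t \<in> V\<rbrakk> \<Longrightarrow> ip u (s - t) = ip u s - ip u t"
  using ip_add[of u "s - t" t] subspace_diff[OF subspace_V, of s t] by simp

lemma ip_sum: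
  assumes "u \<in> V" "\<And>i. i \<in> I \<Longrightarrow> s i \<in> V"
  shows "ip u (sum s I) = (\<Sum>i\<in>I. ip u (s i))"
  using assms(2)
proof (induction I rule: infinite_finite_induct)
  case (insert i I)
  then have "sum s I \<in> V" by (intro subspace_sum subspace_V) auto
  with insert assms(1) show ?case by (simp add: ip_add)
qed (auto simp: ip_zero assms)

lemma ip_combination:
  assumes "u \<in> V" "\<And>i. i \<in> I \<Longrightarrow> s i \<in> V"
  shows "ip u (\<Sum>i\<in>I. scale (c i) (s i)) = (\<Sum>i\<in>I. c i * ip u (s i))"
  using assms by (subst ip_sum) (auto simp: ip_scale subspace_scale[OF subspace_V])

lemma ip_self: "s \<in> V \<Longrightarrow> ip s s = of_real (Re (ip s s))"
  using ip_cnj[of s s] by (metis complex_cnj_cancel_iff complex_is_Real_iff Reals_cnj_iff of_real_Re)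

lemma ip_basis_combination:
  assumes "orthonormal E" "e \<in> E"
  shows "ip e (\<Sum>x\<in>E. scale (c x) x) = c e"
proof -
  have "ip e (\<Sum>x\<in>E. scale (c x) x) = (\<Sum>x\<in>E. c x * ip e x)"
    using orthonormalD[OF assms(1)] assms(2) by (intro ip_combination) auto
  also have "\<dots> = (\<Sum>x\<in>E. if x = e then c x else 0)"
    using orthonormalD[OF assms(1)] assms(2) by (intro sum.cong) auto
  finally show ?thesis using orthonormalD[OF assms(1)] assms(2) by simp
qed

lemma orthonormal_expansion:
  assumes E: "orthonormal E" and t: "t \<in> span E"
  shows "t = (\<Sum>e\<in>E. scale (ip e t) e)"
proof -
  obtain c where c: "t = (\<Sum>e\<in>E. scale (c e) e)"
    using t span_finite[OF orthonormalD(1)[OF E]] by auto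
  have "ip e t = c e" if "e \<in> E" for e
    unfolding c using E that by (rule ip_basis_combination)
  then show ?thesis using c by simp
qed

lemma gram_schmidt:
  assumes "finite B" "B \<subseteq> V"
  shows "\<exists>E. orthonormal E \<and> span E = span B"
  using assms
proof (induction B rule: finite_induct)
  case empty
  show ?case by (rule exI[of _ "{}"]) (simp add: orthonormal_def)
next
  case (insert b B)
  then obtain E where E: "orthonormal E" and span: "span E = span B" by auto
  note E' = orthonormalD[OF E]
  have b: "b \<in> V" using insert by simp
  define p where "p = (\<Sum>e\<in>E. scale (ip e b) e)"
  define r where "r = b - p"
  have p_span: "p \<in> span E"
    unfolding p_def by (intro span_sum span_scale span_base)
  have p: "p \<in> V"
    unfolding p_def using E' by (intro subspace_sum subspace_scale subspace_V) auto
  have r: "r \<in> V" unfolding r_def using b p by (intro subspace_diff subspace_V)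
  have orth: "ip e r = 0" if "e \<in> E" for e
  proof -
    have "ip e p = ip e b" unfolding p_def using E that by (rule ip_basis_combination)
    then show ?thesis using that E' b p unfolding r_def by (subst ip_diff) auto
  qed
  have span_b: "span (insert b B) = span (insert b E)"
    by (simp add: span span_insert)
  \<comment> \<open>\<open>B\<close> may be linearly dependent, so the residual \<open>r\<close> of
    \<open>b\<close> can vanish; then \<open>b\<close> adds nothing to the span and \<open>E\<close>
    is kept.\<close>
  show ?case
  proof (cases "r = 0")
    case True
    then have "b \<in> span E" using p_span by (simp add: r_def)
    then have "span (insert b E) = span E" by (rule span_redundant)
    with E show ?thesis using span_b by blast
  next
    case False
    define d where "d = sqrt (Re (ip r r))"
    have pos: "Re (ip r r) > 0" using r False by (rule ip_pos)
    then have d: "d > 0" "d * d = Re (ip r r)" by (auto simp: d_def)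
    define q where "q = scale (of_real (inverse d)) r"
    have q: "q \<in> V" unfolding q_def using r by (rule subspace_scale[OF subspace_V])
    have eq: "ip e q = 0" if "e \<in> E" for e
      unfolding q_def using that E' r orth by (subst ip_scale) auto
    have qe: "ip q e = 0" if "e \<in> E" for e
      using ip_cnj[of e q] eq[OF that] that E' q by auto
    have "ip q q = of_real (inverse d) * ip q r"
      unfolding q_def[symmetric] using q r q_def ip_scale by metis
    also have "ip q r = cnj (ip r q)" by (rule ip_cnj[OF r q])
    also have "ip r q = of_real (inverse d) * ip r r"
      unfolding q_def using r r by (rule ip_scale)
    also have "ip r r = of_real (d * d)" using ip_self[OF r] d by simp
    finally have qq: "ip q q = 1" using d(1) by (simp add: field_simps)
    have "q \<notin> E" using eq[of q] qq by auto
    then have "orthonormal (insert q E)"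
      unfolding orthonormal_def using E' q qq eq qe by (auto simp: subset_iff)
    moreover have "span (insert q E) = span (insert b E)"
    proof (rule span_eq[THEN iffD2], intro conjI)
      have "b - p \<in> span (insert b E)"
        using p_span span_mono[of E "insert b E"] by (intro span_diff) (auto intro: span_base)
      then have "q \<in> span (insert b E)" unfolding q_def r_def by (rule span_scale)
      then show "insert q E \<subseteq> span (insert b E)" by (auto intro: span_base)
      have "scale (of_real d) q \<in> span (insert q E)" by (intro span_scale span_base) simp
      moreover have "scale (of_real d) q = r"
        unfolding q_def using d(1) by (simp flip: of_real_mult)
      ultimately have "r + p \<in> span (insert q E)"
        using p_span span_mono[of E "insert q E"] by (intro span_add) auto
      then show "insert b E \<subseteq> span (insert q E)" by (auto simp: r_def intro: span_base)
    qed
    ultimately show ?thesis using span_b by blast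
  qed
qed

lemma ip_parseval:
  assumes E: "orthonormal E" and t: "t \<in> span E"
  shows "Re (ip t t) = (\<Sum>e\<in>E. (cmod (ip e t))\<^sup>2)"
proof -
  note E' = orthonormalD[OF E]
  have tV: "t \<in> V" using span_minimal[OF E'(2) subspace_V] t by auto
  have "ip t t = ip t (\<Sum>e\<in>E. scale (ip e t) e)" using orthonormal_expansion[OF E t] by simp
  also have "\<dots> = (\<Sum>e\<in>E. ip e t * ip t e)" using tV E' by (intro ip_combination) auto
  also have "\<dots> = (\<Sum>e\<in>E. of_real ((cmod (ip e t))\<^sup>2))"
  proof (rule sum.cong)
    fix e assume "e \<in> E"
    then have "ip t e = cnj (ip e t)" using E' tV by (intro ip_cnj) auto
    then show "ip e t * ip t e = of_real ((cmod (ip e t))\<^sup>2)"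
      by (simp only: complex_norm_square)
  qed simp
  finally show ?thesis by simp
qed

text \<open>Keeps a single summand of the Parseval identity; this is the Cauchy-Schwarz inequality
  against a unit vector.\<close>

lemma cmod_ip_le:
  assumes E: "orthonormal E" and t: "t \<in> span E" and e: "e \<in> E"
  shows "cmod (ip e t) \<le> sqrt (Re (ip t t))"
proof -
  have "(cmod (ip e t))\<^sup>2 \<le> (\<Sum>e\<in>E. (cmod (ip e t))\<^sup>2)"
    using e orthonormalD(1)[OF E] by (intro member_le_sum) auto
  then show ?thesis by (intro real_le_rsqrt) (simp add: ip_parseval[OF E t])
qed

text \<open>The description on the left is the one in \<open>hol_proj\<close>. The residual of
  \<open>s\<close> is orthogonal to each \<open>e\<close>, hence to the whole span, and any other
  candidate has the same coefficients.\<close>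

lemma proj_unique:
  assumes E: "orthonormal E" and s: "s \<in> V"
  shows "(THE t. t \<in> span E \<and> (\<forall>u\<in>span E. ip u (s - t) = 0)) = (\<Sum>e\<in>E. scale (ip e s) e)"
    (is "_ = ?p")
proof (rule the_equality)
  note E' = orthonormalD[OF E]
  have sp: "span E \<subseteq> V" using E'(2) subspace_V by (rule span_minimal)
  have p: "?p \<in> span E" by (intro span_sum span_scale span_base)
  have orth: "ip e (s - ?p) = 0" if "e \<in> E" for e
  proof -
    have "ip e (s - ?p) = ip e s - ip e ?p" using that E' s p sp by (intro ip_diff) auto
    then show ?thesis by (simp add: ip_basis_combination[OF E that])
  qed
  have sp_V: "s - ?p \<in> V" using s p sp by (intro subspace_diff subspace_V) auto
  have "ip u (s - ?p) = 0" if u: "u \<in> span E" for u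
  proof -
    have uV: "u \<in> V" using u sp by auto
    \<comment> \<open>\<open>ip\<close> is linear in the second slot only, so \<open>u\<close> is
      expanded there and the result is conjugated back.\<close>
    have "ip (s - ?p) u = ip (s - ?p) (\<Sum>e\<in>E. scale (ip e u) e)"
      using orthonormal_expansion[OF E u] by simp
    also have "\<dots> = (\<Sum>e\<in>E. ip e u * ip (s - ?p) e)"
      using E' sp_V by (intro ip_combination) auto
    also have "\<dots> = 0"
      using orth ip_cnj[of _ "s - ?p"] sp_V E' by (intro sum.neutral) auto
    finally show ?thesis using ip_cnj[OF sp_V uV] by simp
  qed
  with p show "?p \<in> span E \<and> (\<forall>u\<in>span E. ip u (s - ?p) = 0)" by blast
  fix t assume t: "t \<in> span E \<and> (\<forall>u\<in>span E. ip u (s - t) = 0)"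
  have "ip e t = ip e s" if e: "e \<in> E" for e
  proof -
    have "ip e (s - t) = ip e s - ip e t" using t e E' s sp by (intro ip_diff) auto
    then show ?thesis using t span_base[OF e] by auto
  qed
  then show "t = ?p" using orthonormal_expansion[OF E, of t] t by simp
qed

section \<open>Endomorphisms: traces and operator norms\<close>

definition endo :: "'v set \<Rightarrow> ('v \<Rightarrow> 'v) \<Rightarrow> bool" where
  "endo W T \<longleftrightarrow> (\<forall>s\<in>W. T s \<in> W) \<and> (\<forall>s\<in>W. \<forall>t\<in>W. T (s + t) = T s + T t) \<and>
    (\<forall>a. \<forall>s\<in>W. T (scale a s) = scale a (T s))"

lemma endoD:
  assumes "endo W T"
  shows "s \<in> W \<Longrightarrow> T s \<in> W" "s \<in> W \<Longrightarrow> t \<in> W \<Longrightarrow> T (s + t) = T s + T t"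
    "s \<in> W \<Longrightarrow> T (scale a s) = scale a (T s)"
  using assms by (auto simp: endo_def)

text \<open>\<open>endo\<close> grants linearity on \<open>W\<close> only, so every partial sum has
  to be kept inside \<open>W\<close>.\<close>

lemma endo_combination:
  assumes T: "endo W T" and W: "subspace W" and s: "\<And>i. i \<in> I \<Longrightarrow> s i \<in> W"
  shows "T (\<Sum>i\<in>I. scale (c i) (s i)) = (\<Sum>i\<in>I. scale (c i) (T (s i)))"
  using s
proof (induction I rule: infinite_finite_induct)
  case (insert i I)
  have "(\<Sum>i\<in>I. scale (c i) (s i)) \<in> W"
    using insert.prems by (intro subspace_sum[OF W] subspace_scale[OF W]) auto
  with insert show ?case
    by (simp add: endoD[OF T] subspace_scale[OF W])
qed (use endoD(3)[OF T subspace_0[OF W], of 0] in auto)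

lemma endo_comp: "endo W S \<Longrightarrow> endo W T \<Longrightarrow> endo W (\<lambda>s. S (T s))"
  by (simp add: endo_def)

lemma endo_diff: "subspace W \<Longrightarrow> endo W S \<Longrightarrow> endo W T \<Longrightarrow> endo W (\<lambda>s. S s - T s)"
  by (simp add: endo_def subspace_diff scale_right_diff_distrib)

lemma endo_sum:
  assumes W: "subspace W" and T: "\<And>j. j \<in> J \<Longrightarrow> endo W (T j)"
  shows "endo W (\<lambda>s. \<Sum>j\<in>J. scale (a j) (T j s))"
  unfolding endo_def
proof (intro conjI ballI allI)
  fix s t assume s: "s \<in> W" and t: "t \<in> W"
  show "(\<Sum>j\<in>J. scale (a j) (T j s)) \<in> W"
    using T s by (intro subspace_sum[OF W] subspace_scale[OF W]) (auto simp: endo_def)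
  show "(\<Sum>j\<in>J. scale (a j) (T j (s + t))) =
      (\<Sum>j\<in>J. scale (a j) (T j s)) + (\<Sum>j\<in>J. scale (a j) (T j t))"
    unfolding sum.distrib[symmetric] using endoD(2)[OF T s t]
    by (intro sum.cong) (simp_all add: scale_right_distrib)
  show "(\<Sum>j\<in>J. scale (a j) (T j (scale c s))) = scale c (\<Sum>j\<in>J. scale (a j) (T j s))" for c
    unfolding scale_sum_right using endoD(3)[OF T s]
    by (intro sum.cong) (simp_all add: mult.commute)
qed

lemma span_subset_V: "orthonormal E \<Longrightarrow> span E \<subseteq> V"
  using orthonormalD(2) subspace_V by (intro span_minimal)

text \<open>\<open>op_trace\<close> takes an unspecified basis \<open>B\<close>. The coefficients of
  \<open>T b\<close> in \<open>E\<close> are scalar products; after exchanging the sums, the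
  coordinates of \<open>e\<close> in \<open>B\<close> reassemble \<open>e\<close> inside
  \<open>T\<close>, and \<open>B\<close> disappears.\<close>

lemma trace_orthonormal:
  assumes E: "orthonormal E" and B: "independent B" "span B = span E" and finite: "finite B"
    and T: "endo (span E) T"
  shows "(\<Sum>b\<in>B. representation B (T b) b) = (\<Sum>e\<in>E. ip e (T e))"
proof -
  note E' = orthonormalD[OF E]
  note sp = span_subset_V[OF E]
  have eB: "e \<in> span B" if "e \<in> E" for e using that B by (simp add: span_base)
  have bE: "b \<in> span E" if "b \<in> B" for b using that by (simp add: span_base flip: B(2))
  note Tb = endoD(1)[OF T bE]
  have "(\<Sum>b\<in>B. representation B (T b) b)
      = (\<Sum>b\<in>B. \<Sum>e\<in>E. ip e (T b) * representation B e b)"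
  proof (rule sum.cong)
    fix b assume b: "b \<in> B"
    have "representation B (T b) b = representation B (\<Sum>e\<in>E. scale (ip e (T b)) e) b"
      using orthonormal_expansion[OF E Tb[OF b]] by simp
    also have "\<dots> = (\<Sum>e\<in>E. representation B (scale (ip e (T b)) e) b)"
      using B eB by (subst representation_sum) (auto intro: span_scale)
    also have "\<dots> = (\<Sum>e\<in>E. ip e (T b) * representation B e b)"
      using B eB by (intro sum.cong) (auto simp: representation_scale)
    finally show "representation B (T b) b = (\<Sum>e\<in>E. ip e (T b) * representation B e b)" .
  qed simp
  also have "\<dots> = (\<Sum>e\<in>E. \<Sum>b\<in>B. ip e (T b) * representation B e b)" by (rule sum.swap)
  also have "\<dots> = (\<Sum>e\<in>E. ip e (T e))"
  proof (rule sum.cong)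
    fix e assume e: "e \<in> E"
    have "e = (\<Sum>b\<in>B. scale (representation B e b) b)"
      using sum_representation_eq[OF B(1) eB[OF e] finite] by simp
    then have "T e = T (\<Sum>b\<in>B. scale (representation B e b) b)" by (rule arg_cong)
    also have "\<dots> = (\<Sum>b\<in>B. scale (representation B e b) (T b))"
      by (rule endo_combination[OF T subspace_span bE])
    finally have "ip e (T e) = ip e (\<Sum>b\<in>B. scale (representation B e b) (T b))"
      by (rule arg_cong)
    also have "\<dots> = (\<Sum>b\<in>B. representation B e b * ip e (T b))"
      using e E' Tb sp by (intro ip_combination) auto
    finally show "(\<Sum>b\<in>B. ip e (T b) * representation B e b) = ip e (T e)"
      by (simp add: mult.commute)
  qed simp
  finally show ?thesis .
qed

text \<open>Expanding the inner vector makes both traces the same double sum of products of two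
  matrix entries, with the roles of the indices exchanged.\<close>

lemma trace_commute:
  assumes E: "orthonormal E" and S: "endo (span E) S" and T: "endo (span E) T"
  shows "(\<Sum>e\<in>E. ip e (S (T e))) = (\<Sum>e\<in>E. ip e (T (S e)))"
proof -
  note E' = orthonormalD[OF E]
  note sp = span_subset_V[OF E]
  have expand: "ip e (S (T e)) = (\<Sum>e'\<in>E. ip e' (T e) * ip e (S e'))"
    if S: "endo (span E) S" and T: "endo (span E) T" and e: "e \<in> E" for S T e
  proof -
    have "S (T e) = S (\<Sum>e'\<in>E. scale (ip e' (T e)) e')"
      using orthonormal_expansion[OF E endoD(1)[OF T span_base[OF e]]] by simp
    also have "\<dots> = (\<Sum>e'\<in>E. scale (ip e' (T e)) (S e'))"
      by (rule endo_combination[OF S subspace_span span_base])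
    finally show ?thesis
      using e E' sp endoD(1)[OF S span_base] by (subst ip_combination[symmetric]) auto
  qed
  have "(\<Sum>e\<in>E. ip e (S (T e))) = (\<Sum>e\<in>E. \<Sum>e'\<in>E. ip e' (T e) * ip e (S e'))"
    using expand[OF S T] by simp
  also have "\<dots> = (\<Sum>e'\<in>E. \<Sum>e\<in>E. ip e' (T e) * ip e (S e'))" by (rule sum.swap)
  also have "\<dots> = (\<Sum>e\<in>E. ip e (T (S e)))"
    using expand[OF T S] by (simp add: mult.commute)
  finally show ?thesis .
qed

text \<open>A real supremum over an unbounded set carries no information, so boundedness has to
  precede any use of the operator norm. The coordinates of a vector in the unit ball are at most 1,
  which bounds each coordinate of its image by a row sum of the matrix of \<open>D\<close>.\<close>

lemma norm_endo_bdd_above: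
  assumes E: "orthonormal E" and D: "endo (span E) D"
  shows "bdd_above ((\<lambda>s. sqrt (Re (ip (D s) (D s)))) ` {s \<in> span E. sqrt (Re (ip s s)) \<le> 1})"
proof (rule bdd_aboveI2)
  note E' = orthonormalD[OF E]
  note sp = span_subset_V[OF E]
  fix s assume "s \<in> {s \<in> span E. sqrt (Re (ip s s)) \<le> 1}"
  then have s: "s \<in> span E" "sqrt (Re (ip s s)) \<le> 1" by auto
  have "cmod (ip e (D s)) \<le> (\<Sum>e'\<in>E. cmod (ip e (D e')))" if e: "e \<in> E" for e
  proof -
    have "D s = D (\<Sum>e'\<in>E. scale (ip e' s) e')" using orthonormal_expansion[OF E s(1)] by simp
    also have "\<dots> = (\<Sum>e'\<in>E. scale (ip e' s) (D e'))"
      by (rule endo_combination[OF D subspace_span span_base])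
    finally have "ip e (D s) = (\<Sum>e'\<in>E. ip e' s * ip e (D e'))"
      using e E' sp endoD(1)[OF D span_base] by (subst ip_combination[symmetric]) auto
    then have "cmod (ip e (D s)) \<le> (\<Sum>e'\<in>E. cmod (ip e' s * ip e (D e')))"
      using norm_sum by metis
    also have "\<dots> \<le> (\<Sum>e'\<in>E. cmod (ip e (D e')))"
    proof (rule sum_mono)
      fix e' assume "e' \<in> E"
      then have "cmod (ip e' s) \<le> 1" using cmod_ip_le[OF E s(1)] s(2) by (meson order_trans)
      then show "cmod (ip e' s * ip e (D e')) \<le> cmod (ip e (D e'))"
        by (simp add: norm_mult mult_left_le_one_le)
    qed
    finally show ?thesis .
  qed
  then have "(\<Sum>e\<in>E. (cmod (ip e (D s)))\<^sup>2) \<le> (\<Sum>e\<in>E. (\<Sum>e'\<in>E. cmod (ip e (D e')))\<^sup>2)"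
    by (intro sum_mono power_mono) auto
  then show "sqrt (Re (ip (D s) (D s))) \<le> sqrt (\<Sum>e\<in>E. (\<Sum>e'\<in>E. cmod (ip e (D e')))\<^sup>2)"
    by (simp add: ip_parseval[OF E endoD(1)[OF D s(1)]])
qed

text \<open>Each of the \<open>card E\<close> diagonal entries is at most the norm of
  \<open>D e\<close>, and \<open>e\<close> itself lies in the unit ball.\<close>

lemma cmod_trace_le:
  assumes E: "orthonormal E" and D: "endo (span E) D"
  shows "cmod (\<Sum>e\<in>E. ip e (D e)) \<le>
    real (card E) * (SUP s\<in>{s \<in> span E. sqrt (Re (ip s s)) \<le> 1}. sqrt (Re (ip (D s) (D s))))"
proof -
  have "cmod (ip e (D e)) \<le>
      (SUP s\<in>{s \<in> span E. sqrt (Re (ip s s)) \<le> 1}. sqrt (Re (ip (D s) (D s))))" if e: "e \<in> E" for e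
  proof (rule order_trans)
    show "cmod (ip e (D e)) \<le> sqrt (Re (ip (D e) (D e)))"
      by (rule cmod_ip_le[OF E endoD(1)[OF D span_base[OF e]] e])
    show "sqrt (Re (ip (D e) (D e))) \<le>
        (SUP s\<in>{s \<in> span E. sqrt (Re (ip s s)) \<le> 1}. sqrt (Re (ip (D s) (D s))))"
      using e orthonormalD(3)[OF E e e]
      by (intro cSUP_upper norm_endo_bdd_above[OF E D]) (auto intro: span_base)
  qed
  then show ?thesis by (intro order_trans[OF norm_sum sum_bounded_above])
qed

text \<open>With a product of two Toeplitz operators for \<open>S\<close> and the terms of a
  truncated expansion for \<open>a j\<close> and \<open>T j\<close>, \<open>D\<close> is the
  remainder in the star product estimate.\<close>

lemma cmod_trace_diff_le:
  fixes a :: "'j \<Rightarrow> complex"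
  assumes E: "orthonormal E" and S: "endo (span E) S" and T: "\<And>j. j \<in> J \<Longrightarrow> endo (span E) (T j)"
  defines "D \<equiv> (\<lambda>s. S s - (\<Sum>j\<in>J. scale (a j) (T j s)))"
  shows "cmod ((\<Sum>e\<in>E. ip e (S e)) - (\<Sum>j\<in>J. a j * (\<Sum>e\<in>E. ip e (T j e)))) \<le>
    real (card E) * (SUP s\<in>{s \<in> span E. sqrt (Re (ip s s)) \<le> 1}. sqrt (Re (ip (D s) (D s))))"
proof -
  note E' = orthonormalD[OF E]
  note sp = span_subset_V[OF E]
  have sum: "endo (span E) (\<lambda>s. \<Sum>j\<in>J. scale (a j) (T j s))"
    by (rule endo_sum[OF subspace_span T])
  have D: "endo (span E) D"
    unfolding D_def by (rule endo_diff[OF subspace_span S sum])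
  have "ip e (D e) = ip e (S e) - (\<Sum>j\<in>J. a j * ip e (T j e))" if e: "e \<in> E" for e
  proof -
    have "ip e (D e) = ip e (S e) - ip e (\<Sum>j\<in>J. scale (a j) (T j e))"
      unfolding D_def using e E' sp endoD(1)[OF S span_base[OF e]] endoD(1)[OF sum span_base[OF e]]
      by (intro ip_diff) auto
    also have "ip e (\<Sum>j\<in>J. scale (a j) (T j e)) = (\<Sum>j\<in>J. a j * ip e (T j e))"
      using e E' sp endoD(1)[OF T span_base[OF e]] by (intro ip_combination) auto
    finally show ?thesis .
  qed
  then have "(\<Sum>e\<in>E. ip e (D e)) = (\<Sum>e\<in>E. ip e (S e)) - (\<Sum>e\<in>E. \<Sum>j\<in>J. a j * ip e (T j e))"
    by (simp add: sum_subtractf)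
  also have "(\<Sum>e\<in>E. \<Sum>j\<in>J. a j * ip e (T j e)) = (\<Sum>j\<in>J. a j * (\<Sum>e\<in>E. ip e (T j e)))"
    unfolding sum_distrib_left by (rule sum.swap)
  finally show ?thesis using cmod_trace_le[OF E D] by simp
qed

end

section \<open>Asymptotic expansions in inverse powers\<close>

text \<open>Strong induction on \<open>r\<close>: with the lower coefficients gone, multiplication
  by \<open>m^r\<close> makes the sum converge to \<open>a r\<close>, while the O-bound, of higher
  order since \<open>r < N\<close>, forces the limit 0.\<close>

lemma inverse_power_expansion_unique:
  fixes a :: "nat \<Rightarrow> complex"
  assumes O: "(\<lambda>m. \<Sum>r<N. a r / of_nat m ^ r) \<in> O(\<lambda>m. 1 / of_nat m ^ N)" and "r < N"
  shows "a r = 0"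
  using \<open>r < N\<close>
proof (induction r rule: less_induct)
  case (less r)
  obtain c where c: "eventually (\<lambda>m. norm (\<Sum>r<N. a r / of_nat m ^ r)
        \<le> c * norm (1 / of_nat m ^ N :: complex)) sequentially"
    using landau_o.bigE[OF O] by auto
  have split: "{..<N} = {..<r} \<union> {r..<N}" using less.prems by auto
  have eq: "of_nat m ^ r * (\<Sum>r<N. a r / of_nat m ^ r) =
      (\<Sum>k\<in>{r..<N}. a k * (1 / of_nat m) ^ (k - r))" if "m > 0" for m :: nat
  proof -
    have "(\<Sum>r<N. a r / of_nat m ^ r) = (\<Sum>k\<in>{r..<N}. a k / of_nat m ^ k)"
      unfolding split using less by (subst sum.union_disjoint) auto
    then have "of_nat m ^ r * (\<Sum>r<N. a r / of_nat m ^ r) =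
        (\<Sum>k\<in>{r..<N}. of_nat m ^ r * (a k / of_nat m ^ k))"
      by (simp only: sum_distrib_left)
    then show ?thesis
      using that by (auto intro!: sum.cong simp: power_one_over power_diff field_simps)
  qed
  have inv0: "(\<lambda>m. 1 / of_nat m :: complex) \<longlonglongrightarrow> 0" by (rule lim_1_over_n)
  have "(\<lambda>m. \<Sum>k\<in>{r..<N}. a k * (1 / of_nat m) ^ (k - r)) \<longlonglongrightarrow> (\<Sum>k\<in>{r..<N}. a k * 0 ^ (k - r))"
    by (intro tendsto_intros inv0)
  \<comment> \<open>\<open>0 ^ 0 = 1\<close>, so the term \<open>k = r\<close> is the one that
    survives.\<close>
  also have "(\<Sum>k\<in>{r..<N}. a k * 0 ^ (k - r)) = (\<Sum>k\<in>{r..<N}. if k = r then a k else 0)"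
    by (intro sum.cong) auto
  also have "\<dots> = a r" using less.prems by simp
  finally have lim1: "(\<lambda>m. \<Sum>k\<in>{r..<N}. a k * (1 / of_nat m) ^ (k - r)) \<longlonglongrightarrow> a r" .
  have "(\<lambda>m. \<Sum>k\<in>{r..<N}. a k * (1 / of_nat m) ^ (k - r)) \<longlonglongrightarrow> 0"
  proof (rule Lim_null_comparison)
    show "eventually (\<lambda>m. norm (\<Sum>k\<in>{r..<N}. a k * (1 / of_nat m) ^ (k - r))
        \<le> c * (1 / real m) ^ (N - r)) sequentially"
      using c eventually_gt_at_top[of 0]
    proof eventually_elim
      case (elim m)
      have "norm (\<Sum>k\<in>{r..<N}. a k * (1 / of_nat m) ^ (k - r))
          = real m ^ r * norm (\<Sum>r<N. a r / of_nat m ^ r)"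
        using elim by (simp add: eq[symmetric] norm_mult norm_power)
      also have "\<dots> \<le> real m ^ r * (c * norm (1 / of_nat m ^ N :: complex))"
        using elim by (intro mult_left_mono) auto
      also have "\<dots> = c * (1 / real m) ^ (N - r)"
        using elim less.prems
        by (simp add: norm_divide norm_power power_one_over power_diff field_simps)
      finally show ?case .
    qed
    have "(\<lambda>m. (1 / real m) ^ (N - r)) \<longlonglongrightarrow> 0 ^ (N - r)"
      by (intro tendsto_intros lim_1_over_n)
    then show "(\<lambda>m. c * (1 / real m) ^ (N - r)) \<longlonglongrightarrow> 0"
      using less.prems by (intro tendsto_mult_right_zero) (simp add: zero_power)
  qed
  with lim1 show ?case using LIMSEQ_unique by blast
qed

section \<open>Positivity of the Pfaffian of a positive Hermitian form\<close>

lemma permutation_iff_bij: "permutation p \<longleftrightarrow> bij p" for p :: "'a::finite \<Rightarrow> 'a"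
  by (auto simp: permutation)

text \<open>A permutation that maps pairs onto pairs is a permutation of the pairs composed with
  such a flip; \<open>b \<noteq> (j \<in> S)\<close> is exclusive or.\<close>

definition pair_flip :: "'n set \<Rightarrow> 'n \<times> bool \<Rightarrow> 'n \<times> bool" where
  "pair_flip S = (\<lambda>(j, b). (j, b \<noteq> (j \<in> S)))"

lemma pair_flip_invol: "pair_flip S \<circ> pair_flip S = id"
  by (auto simp: pair_flip_def fun_eq_iff)

lemma bij_pair_flip: "bij (pair_flip S)"
  using pair_flip_invol by (rule o_bij) (rule pair_flip_invol)

text \<open>Each element of \<open>S\<close> contributes one transposition.\<close>

lemma sign_pair_flip:
  fixes S :: "'n::finite set"
  shows "sign (pair_flip S) = (- 1) ^ card S"
proof (induction S rule: finite_induct[OF finite])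
  case 1
  have "pair_flip {} = (id :: 'n \<times> bool \<Rightarrow> _)" by (auto simp: pair_flip_def)
  then show ?case by simp
next
  case (2 a S)
  have "pair_flip (insert a S) = Transposition.transpose (a, False) (a, True) \<circ> pair_flip S"
    using 2 by (auto simp: pair_flip_def fun_eq_iff Transposition.transpose_def)
  then show ?case using 2
    by (simp add: sign_compose permutation_iff_bij bij_pair_flip sign_swap_id del: o_apply comp_apply)
qed

lemma sign_square: "sign p * sign p = 1"
  by (simp add: sign_def)

text \<open>The two copies of \<open>\<pi>\<close> are conjugate under the flip of all pairs, so their signs cancel.\<close>

lemma sign_map_prod_pairs:
  fixes \<pi> :: "'n::finite \<Rightarrow> 'n"
  assumes "bij \<pi>"
  shows "sign (map_prod \<pi> (id :: bool \<Rightarrow> bool)) = 1"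
proof -
  define \<alpha> where "\<alpha> = (\<lambda>(j, b). if b then (j, b) else (\<pi> j, b))"
  define s where "s = (pair_flip UNIV :: 'n \<times> bool \<Rightarrow> _)"
  define \<beta> where "\<beta> = s \<circ> \<alpha> \<circ> s"
  have inj: "inj \<alpha>"
    using bij_is_inj[OF assms] by (auto simp: \<alpha>_def inj_on_def split: if_splits)
  then have \<alpha>: "bij \<alpha>" by (simp add: finite_UNIV_inj_surj bij_def finite_UNIV_surj_inj)
  have s: "bij s" unfolding s_def by (rule bij_pair_flip)
  have "map_prod \<pi> id = \<alpha> \<circ> \<beta>"
    by (auto simp: fun_eq_iff \<alpha>_def \<beta>_def s_def pair_flip_def)
  moreover have "sign \<beta> = sign \<alpha>"
    unfolding \<beta>_def using \<alpha> s
    by (simp add: sign_compose permutation_iff_bij bij_comp mult.assoc mult.left_commute[of "sign s"]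
        sign_square)
  moreover have "bij \<beta>" unfolding \<beta>_def using \<alpha> s by (intro bij_comp)
  ultimately show ?thesis using \<alpha> by (simp add: sign_compose permutation_iff_bij sign_square)
qed

section \<open>The Pfaffian as an alternating multilinear function\<close>

locale skew_form =
  fixes B :: "'v::real_vector \<Rightarrow> 'v \<Rightarrow> real"
  assumes linear_left: "linear (\<lambda>u. B u w)" and skew: "B u v = - B v u"
begin

lemma linear_right: "linear (B u)"
proof -
  have "B u = (\<lambda>v. - B v u)" by (rule ext) (rule skew)
  then show ?thesis using linear_compose_neg[OF linear_left] by simp
qed

lemma self_zero: "B u u = 0"
  using skew[of u u] by linarith

text \<open>With \<open>n = CARD('n)\<close>, this is \<open>2^n n!\<close> times the usual Pfaffian
  of the matrix with entries \<open>B (x p) (x q)\<close>; it is the sum in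
  \<open>liouville_density\<close>.\<close>

definition pfaffian :: "('n::finite \<times> bool \<Rightarrow> 'v) \<Rightarrow> real" where
  "pfaffian x = (\<Sum>\<sigma> | \<sigma> permutes UNIV.
     of_int (sign \<sigma>) * (\<Prod>j\<in>UNIV. B (x (\<sigma> (j, False))) (x (\<sigma> (j, True)))))"

text \<open>Composition with the transposition of \<open>p\<close> and \<open>q\<close> permutes the
  summation range, fixes every product because \<open>x p = x q\<close>, and reverses every
  sign.\<close>

lemma pfaffian_alternating:
  fixes x :: "'n::finite \<times> bool \<Rightarrow> 'v"
  assumes "p \<noteq> q" "x p = x q"
  shows "pfaffian x = 0"
proof -
  have inv: "x (Transposition.transpose p q r) = x r" for r using assms by (auto simp: Transposition.transpose_def)
  have "pfaffian x = (\<Sum>\<sigma> | \<sigma> permutes UNIV. of_int (sign (Transposition.transpose p q \<circ> \<sigma>)) *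
      (\<Prod>j\<in>UNIV. B (x ((Transposition.transpose p q \<circ> \<sigma>) (j, False))) (x ((Transposition.transpose p q \<circ> \<sigma>) (j, True)))))"
    unfolding pfaffian_def
    by (rule setum_permutations_compose_left) (simp add: permutes_swap_id)
  also have "\<dots> = - pfaffian x"
    unfolding pfaffian_def sum_negf[symmetric]
  proof (rule sum.cong)
    fix \<sigma> assume "\<sigma> \<in> {\<sigma>. \<sigma> permutes (UNIV :: ('n \<times> bool) set)}"
    then have "sign (Transposition.transpose p q \<circ> \<sigma>) = - sign \<sigma>"
      using assms(1) permutes_bij[of \<sigma> UNIV]
      by (simp add: sign_compose permutation_iff_bij sign_swap_id)
    then show "of_int (sign (Transposition.transpose p q \<circ> \<sigma>)) *
        (\<Prod>j\<in>UNIV. B (x ((Transposition.transpose p q \<circ> \<sigma>) (j, False))) (x ((Transposition.transpose p q \<circ> \<sigma>) (j, True)))) =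
      - (of_int (sign \<sigma>) * (\<Prod>j\<in>UNIV. B (x (\<sigma> (j, False))) (x (\<sigma> (j, True)))))"
      by (simp add: inv)
  qed simp
  finally show ?thesis by simp
qed

text \<open>A permutation takes the value \<open>p\<close> exactly once, so \<open>y\<close> occurs
  in one argument of one factor of each term.\<close>

lemma linear_pfaffian_slot:
  fixes x :: "'n::finite \<times> bool \<Rightarrow> 'v"
  shows "linear (\<lambda>y. pfaffian (x(p := y)))"
proof -
  have "linear (\<lambda>y. \<Prod>j\<in>UNIV. B ((x(p := y)) (\<sigma> (j, False))) ((x(p := y)) (\<sigma> (j, True))))"
    if \<sigma>: "\<sigma> permutes UNIV" for \<sigma>
  proof -
    obtain j b where p: "\<sigma> (j, b) = p" using permutes_surj[OF \<sigma>] by (metis surjD surj_pair)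
    have ne: "\<sigma> r \<noteq> p" if "r \<noteq> (j, b)" for r
      using permutes_inj[OF \<sigma>] that p by (metis injD)
    define c where "c = (\<Prod>k\<in>UNIV - {j}. B (x (\<sigma> (k, False))) (x (\<sigma> (k, True))))"
    have "(\<lambda>y. \<Prod>k\<in>UNIV. B ((x(p := y)) (\<sigma> (k, False))) ((x(p := y)) (\<sigma> (k, True)))) =
      (\<lambda>y. c * (if b then B (x (\<sigma> (j, False))) y else B y (x (\<sigma> (j, True)))))"
    proof
      fix y
      have "(\<Prod>k\<in>UNIV. B ((x(p := y)) (\<sigma> (k, False))) ((x(p := y)) (\<sigma> (k, True)))) =
        B ((x(p := y)) (\<sigma> (j, False))) ((x(p := y)) (\<sigma> (j, True))) *
        (\<Prod>k\<in>UNIV - {j}. B ((x(p := y)) (\<sigma> (k, False))) ((x(p := y)) (\<sigma> (k, True))))"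
        by (rule prod.remove) auto
      also have "(\<Prod>k\<in>UNIV - {j}. B ((x(p := y)) (\<sigma> (k, False))) ((x(p := y)) (\<sigma> (k, True)))) = c"
        unfolding c_def using ne by (intro prod.cong) auto
      finally show "(\<Prod>k\<in>UNIV. B ((x(p := y)) (\<sigma> (k, False))) ((x(p := y)) (\<sigma> (k, True)))) =
        c * (if b then B (x (\<sigma> (j, False))) y else B y (x (\<sigma> (j, True))))"
        using p ne by (cases b) auto
    qed
    moreover have "linear (\<lambda>y. c * (if b then B (x (\<sigma> (j, False))) y else B y (x (\<sigma> (j, True)))))"
      using linear_compose_scale_right[OF linear_right, of c] linear_compose_scale_right[OF linear_left, of c]
      by (cases b) auto
    ultimately show ?thesis by simp
  qed
  then show ?thesis
    unfolding pfaffian_def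
    by (intro linear_compose_sum ballI linear_compose_scale_right[where 'b = real, simplified]) auto
qed

text \<open>Invariance under elementary column operations: each added multiple contributes a
  Pfaffian with a repeated vector.\<close>

lemma pfaffian_add_combination:
  fixes x :: "'n::finite \<times> bool \<Rightarrow> 'v"
  assumes "p \<notin> Q"
  shows "pfaffian (x(p := x p + (\<Sum>q\<in>Q. r q *\<^sub>R x q))) = pfaffian x"
proof -
  have "pfaffian (x(p := x q)) = 0" if "q \<in> Q" for q
    using that assms by (intro pfaffian_alternating[of p q]) auto
  then show ?thesis
    by (simp add: linear_add[OF linear_pfaffian_slot] linear_sum[OF linear_pfaffian_slot]
        linear_scale[OF linear_pfaffian_slot])
qed

text \<open>A nonzero product forces \<sigma> to map every pair onto a pair, since vectors from
  different pairs are orthogonal. Then \<sigma> is a permutation \<pi> of the pairs after a flip of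
  the pairs in \<open>S\<close>. The former is even; the latter contributes
  \<open>(-1) ^ card S\<close> once through its sign and once through skewness of \<open>B\<close>,
  and the two cancel.\<close>

lemma pfaffian_term_orthogonal:
  fixes x :: "'n::finite \<times> bool \<Rightarrow> 'v"
  assumes orth: "\<And>j k b c. j \<noteq> k \<Longrightarrow> B (x (j, b)) (x (k, c)) = 0"
    and \<sigma>: "\<sigma> permutes UNIV"
    and nz: "(\<Prod>j\<in>UNIV. B (x (\<sigma> (j, False))) (x (\<sigma> (j, True)))) \<noteq> 0"
  shows "of_int (sign \<sigma>) * (\<Prod>j\<in>UNIV. B (x (\<sigma> (j, False))) (x (\<sigma> (j, True)))) =
    (\<Prod>j\<in>UNIV. B (x (j, False)) (x (j, True)))"
proof -
  define \<pi> where "\<pi> j = fst (\<sigma> (j, False))" for j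
  define S where "S = {j. snd (\<sigma> (j, False))}"
  have nz': "B (x (\<sigma> (j, False))) (x (\<sigma> (j, True))) \<noteq> 0" for j
    using nz by (simp add: prod_zero_iff)
  have same: "fst (\<sigma> (j, True)) = \<pi> j" for j
    using nz'[of j] orth[of "fst (\<sigma> (j, False))" "fst (\<sigma> (j, True))"
      "snd (\<sigma> (j, False))" "snd (\<sigma> (j, True))"] unfolding \<pi>_def prod.collapse by metis
  have other: "snd (\<sigma> (j, True)) \<longleftrightarrow> \<not> snd (\<sigma> (j, False))" for j
  proof -
    \<comment> \<open>Any two images are distinct by \<open>B u u = 0\<close>; lying in the same
      pair, they are its two members.\<close>
    have "\<sigma> (j, True) \<noteq> \<sigma> (j, False)" using nz'[of j] self_zero by metis
    then show ?thesis using same[of j] prod_eqI[of "\<sigma> (j, True)" "\<sigma> (j, False)"]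
      unfolding \<pi>_def by blast
  qed
  have \<sigma>_eq: "\<sigma> = map_prod \<pi> id \<circ> pair_flip S"
  proof
    fix r :: "'n \<times> bool"
    obtain j b where r: "r = (j, b)" by fastforce
    have "\<sigma> (j, False) = (\<pi> j, j \<in> S)" "\<sigma> (j, True) = (\<pi> j, j \<notin> S)"
      using same[of j] other[of j] prod.collapse[of "\<sigma> (j, False)"] prod.collapse[of "\<sigma> (j, True)"]
      unfolding S_def \<pi>_def mem_Collect_eq by metis+
    then show "\<sigma> r = (map_prod \<pi> id \<circ> pair_flip S) r"
      unfolding r by (cases b) (simp_all add: pair_flip_def)
  qed
  have "surj \<pi>"
  proof (unfold surj_def, rule allI)
    fix j obtain k b where "\<sigma> (k, b) = (j, False)"
      using permutes_surj[OF \<sigma>] by (metis surjD surj_pair)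
    then show "\<exists>k. j = \<pi> k" using same[of k] \<pi>_def[of k] by (cases b) (auto intro!: exI[of _ k])
  qed
  then have \<pi>: "bij \<pi>" by (simp add: bij_def finite_UNIV_surj_inj)
  then have "bij (map_prod \<pi> (id :: bool \<Rightarrow> bool))" 
    by (simp add: bij_def prod.inj_map map_prod_surj)
  then have sign: "sign \<sigma> = (- 1) ^ card S"
    unfolding \<sigma>_eq
    by (simp add: sign_compose permutation_iff_bij bij_pair_flip sign_map_prod_pairs[OF \<pi>]
        sign_pair_flip)
  have "(\<Prod>j\<in>UNIV. B (x (\<sigma> (j, False))) (x (\<sigma> (j, True)))) =
      (\<Prod>j\<in>UNIV. (if j \<in> S then - 1 else 1) * B (x (\<pi> j, False)) (x (\<pi> j, True)))"
  proof (rule prod.cong)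
    fix j
    show "B (x (\<sigma> (j, False))) (x (\<sigma> (j, True))) =
        (if j \<in> S then - 1 else 1) * B (x (\<pi> j, False)) (x (\<pi> j, True))"
      using skew[of "x (\<pi> j, True)" "x (\<pi> j, False)"] by (simp add: \<sigma>_eq pair_flip_def)
  qed simp
  also have "\<dots> = (- 1) ^ card S * (\<Prod>j\<in>UNIV. B (x (\<pi> j, False)) (x (\<pi> j, True)))"
    by (simp add: prod.distrib prod.If_cases)
  also have "(\<Prod>j\<in>UNIV. B (x (\<pi> j, False)) (x (\<pi> j, True))) =
      (\<Prod>j\<in>UNIV. B (x (j, False)) (x (j, True)))"
    using \<pi> by (rule prod.reindex_bij_betw[of \<pi> UNIV UNIV "\<lambda>j. B (x (j, False)) (x (j, True))"])
  finally have eq: "(\<Prod>j\<in>UNIV. B (x (\<sigma> (j, False))) (x (\<sigma> (j, True)))) =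
      (- 1) ^ card S * (\<Prod>j\<in>UNIV. B (x (j, False)) (x (j, True)))" .
  have "(- 1) ^ card S * (- 1) ^ card S = (1 :: real)" by (simp flip: power_add)
  then show ?thesis unfolding eq sign by (simp flip: mult.assoc)
qed

lemma pfaffian_orthogonal_pos:
  fixes x :: "'n::finite \<times> bool \<Rightarrow> 'v"
  assumes orth: "\<And>j k b c. j \<noteq> k \<Longrightarrow> B (x (j, b)) (x (k, c)) = 0"
    and pos: "\<And>j. B (x (j, False)) (x (j, True)) > 0"
  shows "pfaffian x > 0"
proof -
  let ?t = "\<lambda>\<sigma>. real_of_int (sign \<sigma>) * (\<Prod>j\<in>UNIV. B (x (\<sigma> (j, False))) (x (\<sigma> (j, True))))"
  have "?t \<sigma> \<ge> 0" if "\<sigma> permutes UNIV" for \<sigma>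
  proof (cases "(\<Prod>j\<in>UNIV. B (x (\<sigma> (j, False))) (x (\<sigma> (j, True)))) = 0")
    case False
    have "?t \<sigma> = (\<Prod>j\<in>UNIV. B (x (j, False)) (x (j, True)))"
      by (rule pfaffian_term_orthogonal) (use orth that False in auto)
    then show ?thesis using pos by (simp add: prod_nonneg less_imp_le)
  next
    case True
    then show ?thesis by (simp only: mult_zero_right order_refl)
  qed
  \<comment> \<open>The term of the identity alone is a lower bound, since the others are
    nonnegative.\<close>
  then have "(\<Sum>\<sigma>\<in>{id}. ?t \<sigma>) \<le> pfaffian x"
    unfolding pfaffian_def by (intro sum_mono2) (auto simp: permutes_id finite_permutations)
  moreover have "?t id > 0" using pos by (simp add: prod_pos)
  ultimately show ?thesis by simp
qed

end

section \<open>Orthogonalizing the standard frame of complex space\<close>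

definition complex_frame :: "('n \<Rightarrow> complex ^ 'm) \<Rightarrow> 'n \<times> bool \<Rightarrow> complex ^ 'm" where
  "complex_frame v = (\<lambda>(j, b). if b then \<i> *s v j else v j)"

text \<open>\<open>B\<close> is the model of a Kaehler form at one point:
  \<open>B u (\<i> *s v)\<close> is the associated real inner product.\<close>

locale positive_skew_form = skew_form B
  for B :: "complex ^ 'n \<Rightarrow> complex ^ 'n \<Rightarrow> real" +
  assumes invariant: "B (\<i> *s u) (\<i> *s v) = B u v"
    and positive: "v \<noteq> 0 \<Longrightarrow> B v (\<i> *s v) > 0"
begin

lemma i_i: "\<i> *s (\<i> *s v) = - v" for v :: "complex ^ 'n"
  by (simp add: vector_smult_assoc)

lemma B_i_right: "B u (\<i> *s v) = - B (\<i> *s u) v"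
proof -
  have "B u (\<i> *s v) = B (\<i> *s u) (- v)" by (simp only: invariant[symmetric, of u] i_i)
  then show ?thesis by (simp only: linear_neg[OF linear_right])
qed

lemma sum_pairs: "(\<Sum>q\<in>S \<times> UNIV. g q) = (\<Sum>k\<in>S. g (k, False) + g (k, True))"
proof -
  have "(\<Sum>q\<in>S \<times> UNIV. g q) = (\<Sum>k\<in>S. \<Sum>b\<in>UNIV. g (k, b))"
    by (simp add: sum.cartesian_product)
  then show ?thesis by (simp add: UNIV_bool add.commute)
qed

text \<open>The invariant of the induction over \<open>S\<close>. The two equations for
  \<open>B\<close> together are orthogonality for the Hermitian form, and the vanishing coordinates
  keep the next \<open>axis a 1\<close> outside the span of the vectors already treated.\<close>

definition orthogonalizes :: "('n \<Rightarrow> complex ^ 'n) \<Rightarrow> 'n set \<Rightarrow> bool" where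
  "orthogonalizes v S \<longleftrightarrow>
    (\<forall>j. j \<notin> S \<longrightarrow> v j = axis j 1) \<and>
    (\<forall>j\<in>S. v j \<noteq> 0) \<and> (\<forall>j\<in>S. \<forall>a. a \<notin> S \<longrightarrow> v j $ a = 0) \<and>
    (\<forall>j\<in>S. \<forall>k\<in>S. j \<noteq> k \<longrightarrow> B (v j) (v k) = 0 \<and> B (\<i> *s v j) (v k) = 0) \<and>
    pfaffian (complex_frame v) = pfaffian (complex_frame (\<lambda>j. axis j 1))"

text \<open>Gram-Schmidt over the complex numbers, without normalization, so that the new vector is
  the old one plus a combination of the others. In the real frame this amounts to two elementary
  operations, one for \<open>v a\<close> and one for \<open>\<i> *s v a\<close>, and neither changes
  the Pfaffian.\<close>

lemma orthogonalizes_exists: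
  assumes "finite S"
  shows "\<exists>v. orthogonalizes v S"
  using assms
proof (induction S rule: finite_induct)
  case empty
  show ?case by (rule exI[of _ "\<lambda>j. axis j 1"]) (simp add: orthogonalizes_def)
next
  case (insert a S)
  then obtain v where v: "orthogonalizes v S" by blast
  have out: "v j = axis j 1" if "j \<notin> S" for j
    using v that unfolding orthogonalizes_def by blast
  have nz: "v j \<noteq> 0" if "j \<in> S" for j
    using v that unfolding orthogonalizes_def by blast
  have coord: "v j $ b = 0" if "j \<in> S" "b \<notin> S" for j b
    using v that unfolding orthogonalizes_def by blast
  have orth: "B (v j) (v k) = 0 \<and> B (\<i> *s v j) (v k) = 0" if "j \<in> S" "k \<in> S" "j \<noteq> k" for j k
    using v that unfolding orthogonalizes_def by blast
  have pf: "pfaffian (complex_frame v) = pfaffian (complex_frame (\<lambda>j. axis j 1))"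
    using v unfolding orthogonalizes_def by blast
  define d where "d k = B (v k) (\<i> *s v k)" for k
  \<comment> \<open>With \<open>d k\<close> the squared length of \<open>v k\<close>, these are the
    real and imaginary parts of the coefficient of \<open>v k\<close> that makes
    \<open>axis a 1 + c\<close> orthogonal to \<open>v k\<close>. Only the k-th summand of
    \<open>c\<close> contributes, so the equations to solve contain
    \<open>B (v k) c = \<beta> k * d k\<close> and
    \<open>B (\<i> *s v k) c = - \<alpha> k * d k\<close>.\<close>
  define \<alpha> where "\<alpha> k = B (\<i> *s v k) (axis a 1) / d k" for k
  define \<beta> where "\<beta> k = - B (v k) (axis a 1) / d k" for k
  define c where "c = (\<Sum>k\<in>S. \<alpha> k *\<^sub>R v k + \<beta> k *\<^sub>R (\<i> *s v k))"
  define v' where "v' = v(a := axis a 1 + c)"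
  have d: "d k > 0" if "k \<in> S" for k unfolding d_def using nz[OF that] by (rule positive)
  have d': "B (\<i> *s v k) (v k) = - d k" for k unfolding d_def by (rule skew)
  have Bc: "B u c = (\<Sum>k\<in>S. \<alpha> k * B u (v k) + \<beta> k * B u (\<i> *s v k))" for u
    unfolding c_def
    by (simp add: linear_sum[OF linear_right] linear_add[OF linear_right] linear_scale[OF linear_right])
  have Bvc: "B (v k) c = \<beta> k * d k" if k: "k \<in> S" for k
  proof -
    have "B (v k) c = (\<Sum>l\<in>S. if l = k then \<beta> k * d k else 0)"
      unfolding Bc using orth k by (intro sum.cong) (auto simp: self_zero d_def B_i_right)
    then show ?thesis using k insert by simp
  qed
  have Bivc: "B (\<i> *s v k) c = - \<alpha> k * d k" if k: "k \<in> S" for k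
  proof -
    have "B (\<i> *s v k) c = (\<Sum>l\<in>S. if l = k then - \<alpha> k * d k else 0)"
      unfolding Bc using orth k by (intro sum.cong) (auto simp: self_zero d' invariant)
    then show ?thesis using k insert by simp
  qed
  have o1: "B (v k) (v' a) = 0" if k: "k \<in> S" for k
    using d[OF k] by (simp add: v'_def linear_add[OF linear_right] Bvc[OF k] \<beta>_def)
  have o2: "B (\<i> *s v k) (v' a) = 0" if k: "k \<in> S" for k
    using d[OF k] by (simp add: v'_def linear_add[OF linear_right] Bivc[OF k] \<alpha>_def)
  have o3: "B (v' a) (v k) = 0" "B (\<i> *s v' a) (v k) = 0" if k: "k \<in> S" for k
    using o1[OF k] o2[OF k] skew[of "v' a" "v k"] skew[of "\<i> *s v' a" "v k"] B_i_right[of "v k" "v' a"]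
    by auto
  have v'S: "v' k = v k" if "k \<in> S" for k using that insert by (auto simp: v'_def)
  have ca: "c $ b = 0" if "b \<notin> S" for b
    unfolding c_def using coord that by (auto simp: sum_component intro!: sum.neutral)
  \<comment> \<open>\<open>c\<close> has no component along \<open>axis a 1\<close>, so the
    coordinate \<open>a\<close> survives the correction.\<close>
  have "v' a $ a = 1" using ca[of a] insert by (simp add: v'_def)
  then have v'nz: "v' a \<noteq> 0" by (metis zero_index zero_neq_one)
  define x where "x = complex_frame v"
  \<comment> \<open>\<open>y\<close> corrects the slot of \<open>v a\<close> by \<open>c\<close>,
    then \<open>z\<close> the slot of \<open>\<i> *s v a\<close> by \<open>\<i> *s c\<close>;
    multiplication by \<i> turns the coefficients \<alpha>, \<beta> into -\<beta>, \<alpha>.\<close>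
  define y where "y = x((a, False) := x (a, False) +
      (\<Sum>q\<in>S \<times> UNIV. (case q of (k, b) \<Rightarrow> if b then \<beta> k else \<alpha> k) *\<^sub>R x q))"
  define z where "z = y((a, True) := y (a, True) +
      (\<Sum>q\<in>S \<times> UNIV. (case q of (k, b) \<Rightarrow> if b then \<alpha> k else - \<beta> k) *\<^sub>R y q))"
  have "pfaffian z = pfaffian y" unfolding z_def using insert by (intro pfaffian_add_combination) auto
  also have "pfaffian y = pfaffian x" unfolding y_def using insert by (intro pfaffian_add_combination) auto
  finally have pfz: "pfaffian z = pfaffian x" .
  have yS: "y (k, b) = x (k, b)" if "k \<in> S" for k b using that insert by (auto simp: y_def)
  have c1: "(\<Sum>q\<in>S \<times> UNIV. (case q of (k, b) \<Rightarrow> if b then \<beta> k else \<alpha> k) *\<^sub>R x q) = c"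
    unfolding c_def sum_pairs by (simp add: x_def complex_frame_def)
  have "(\<Sum>q\<in>S \<times> UNIV. (case q of (k, b) \<Rightarrow> if b then \<alpha> k else - \<beta> k) *\<^sub>R y q) =
      (\<Sum>k\<in>S. \<alpha> k *\<^sub>R (\<i> *s v k) - \<beta> k *\<^sub>R v k)"
    unfolding sum_pairs by (intro sum.cong) (simp_all add: yS x_def complex_frame_def)
  also have "\<dots> = (\<Sum>k\<in>S. \<i> *s (\<alpha> k *\<^sub>R v k + \<beta> k *\<^sub>R (\<i> *s v k)))"
  proof (rule sum.cong)
    fix k
    show "\<alpha> k *\<^sub>R (\<i> *s v k) - \<beta> k *\<^sub>R v k = \<i> *s (\<alpha> k *\<^sub>R v k + \<beta> k *\<^sub>R (\<i> *s v k))"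
      by (simp add: vec_eq_iff distrib_left)
  qed simp
  also have "\<dots> = \<i> *s c" unfolding c_def by (rule vec.scale_sum_right[symmetric])
  finally have c2: "(\<Sum>q\<in>S \<times> UNIV. (case q of (k, b) \<Rightarrow> if b then \<alpha> k else - \<beta> k) *\<^sub>R y q) = \<i> *s c" .
  have "z = complex_frame v'"
  proof
    fix r :: "'n \<times> bool"
    obtain j b where r: "r = (j, b)" by fastforce
    show "z r = complex_frame v' r"
      unfolding r z_def c2 unfolding y_def c1 using out[of a] insert(2)
      by (cases b) (auto simp: x_def complex_frame_def v'_def vector_add_ldistrib)
  qed
  then have "pfaffian (complex_frame v') = pfaffian (complex_frame (\<lambda>j. axis j 1))"
    using pfz pf by (simp add: x_def)
  moreover have "v' j = axis j 1" if "j \<notin> insert a S" for j using out that by (simp add: v'_def)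
  moreover have "v' j \<noteq> 0" if "j \<in> insert a S" for j
    using that v'nz nz v'S by (metis insertE)
  moreover have "v' j $ b = 0" if "j \<in> insert a S" "b \<notin> insert a S" for j b
  proof (cases "j = a")
    case True
    then show ?thesis using that ca[of b] by (simp add: v'_def axis_def)
  next
    case False
    then show ?thesis using that coord v'S by simp
  qed
  moreover have "B (v' j) (v' k) = 0 \<and> B (\<i> *s v' j) (v' k) = 0"
    if "j \<in> insert a S" "k \<in> insert a S" "j \<noteq> k" for j k
    using that o1 o2 o3 orth v'S by (cases "j = a"; cases "k = a") auto
  ultimately have "orthogonalizes v' (insert a S)" unfolding orthogonalizes_def by blast
  then show ?case by (rule exI[of _ v'])
qed

lemma pfaffian_real_frame_pos: "pfaffian (complex_frame (\<lambda>j::'n. axis j 1)) > 0"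
proof -
  obtain v :: "'n \<Rightarrow> complex ^ 'n" where v: "orthogonalizes v UNIV"
    using orthogonalizes_exists[OF finite] by blast
  then have nz: "v j \<noteq> 0" for j by (simp add: orthogonalizes_def)
  have orth: "B (v j) (v k) = 0 \<and> B (\<i> *s v j) (v k) = 0" if "j \<noteq> k" for j k
    using v that by (simp add: orthogonalizes_def)
  have pf: "pfaffian (complex_frame v) = pfaffian (complex_frame (\<lambda>j. axis j 1))"
    using v by (simp add: orthogonalizes_def)
  have "pfaffian (complex_frame v) > 0"
  proof (rule pfaffian_orthogonal_pos)
    fix j k :: 'n and b c assume "j \<noteq> k"
    with orth show "B (complex_frame v (j, b)) (complex_frame v (k, c)) = 0"
      by (auto simp: complex_frame_def B_i_right i_i linear_neg[OF linear_left])
  qed (simp add: complex_frame_def positive nz)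
  with pf show ?thesis by simp
qed

end

section \<open>Smooth functions\<close>

text \<open>Derivatives are taken in the whole space, so agreement on \<open>S\<close> determines
  them because \<open>S\<close> is open.\<close>

lemma Ck_on_cong:
  assumes "open S" "\<And>x. x \<in> S \<Longrightarrow> f x = g x" "Ck_on k S f"
  shows "Ck_on k S g"
  using assms(2,3)
proof (induction k arbitrary: f g)
  case 0
  then show ?case by (auto cong: continuous_on_cong)
next
  case (Suc k)
  have df: "f differentiable at x" if "x \<in> S" for x using Suc.prems that by simp
  have "g differentiable at x" if x: "x \<in> S" for x
    using has_derivative_transform_within_open[OF iffD1[OF frechet_derivative_works df[OF x]] assms(1) x]
      Suc.prems(1) by (auto simp: differentiable_def)
  moreover have "Ck_on k S (\<lambda>x. frechet_derivative g (at x) v)" for v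
  proof (rule Suc.IH)
    show "Ck_on k S (\<lambda>x. frechet_derivative f (at x) v)" using Suc.prems by simp
    show "frechet_derivative f (at x) v = frechet_derivative g (at x) v" if "x \<in> S" for x
      using frechet_derivative_transform_within_open[OF df[OF that] assms(1) that] Suc.prems(1)
      by simp
  qed
  ultimately show ?case by simp
qed

text \<open>Serves the product rule, where the derivative still contains the undifferentiated
  factors.\<close>

lemma Ck_on_SucD: "Ck_on (Suc k) S f \<Longrightarrow> Ck_on k S f"
proof (induction k arbitrary: f)
  case 0
  then show ?case
    by (auto intro!: continuous_at_imp_continuous_on differentiable_imp_continuous_within)
next
  case (Suc k)
  then show ?case unfolding Ck_on.simps(2)[of "Suc k"] by (simp only: Ck_on.simps(2)) blast
qed

lemma Ck_on_const: "Ck_on k S (\<lambda>_. c)"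
  by (induction k arbitrary: c) auto

lemma Ck_on_add:
  assumes "open S" "Ck_on k S f" "Ck_on k S g"
  shows "Ck_on k S (\<lambda>x. f x + g x)"
  using assms(2,3)
proof (induction k arbitrary: f g)
  case 0
  then show ?case by (auto intro: continuous_on_add)
next
  case (Suc k)
  have d: "((\<lambda>x. f x + g x) has_derivative
      (\<lambda>v. frechet_derivative f (at x) v + frechet_derivative g (at x) v)) (at x)" if "x \<in> S" for x
    using Suc.prems that by (intro has_derivative_add iffD1[OF frechet_derivative_works]) auto
  have "Ck_on k S (\<lambda>x. frechet_derivative (\<lambda>x. f x + g x) (at x) v)" for v
  proof (rule Ck_on_cong[OF assms(1)])
    show "Ck_on k S (\<lambda>x. frechet_derivative f (at x) v + frechet_derivative g (at x) v)"
      using Suc by simp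
    show "frechet_derivative f (at x) v + frechet_derivative g (at x) v =
        frechet_derivative (\<lambda>x. f x + g x) (at x) v" if "x \<in> S" for x
      using frechet_derivative_at[OF d[OF that]] by metis
  qed
  with d show ?case by (auto simp: differentiable_def)
qed

lemma Ck_on_mult:
  fixes f g :: "'v::real_normed_vector \<Rightarrow> 'w::real_normed_algebra"
  assumes "open S" "Ck_on k S f" "Ck_on k S g"
  shows "Ck_on k S (\<lambda>x. f x * g x)"
  using assms(2,3)
proof (induction k arbitrary: f g)
  case 0
  then show ?case by (auto intro: continuous_on_mult)
next
  case (Suc k)
  have d: "((\<lambda>x. f x * g x) has_derivative
      (\<lambda>v. f x * frechet_derivative g (at x) v + frechet_derivative f (at x) v * g x)) (at x)"
    if "x \<in> S" for x
    using Suc.prems that by (intro has_derivative_mult iffD1[OF frechet_derivative_works]) auto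
  have "Ck_on k S (\<lambda>x. frechet_derivative (\<lambda>x. f x * g x) (at x) v)" for v
  proof (rule Ck_on_cong[OF assms(1)])
    show "Ck_on k S (\<lambda>x. f x * frechet_derivative g (at x) v + frechet_derivative f (at x) v * g x)"
      using Suc.prems Suc.prems[THEN Ck_on_SucD] by (intro Ck_on_add assms(1) Suc.IH) simp_all
    show "f x * frechet_derivative g (at x) v + frechet_derivative f (at x) v * g x =
        frechet_derivative (\<lambda>x. f x * g x) (at x) v" if "x \<in> S" for x
      using frechet_derivative_at[OF d[OF that]] by metis
  qed
  with d show ?case by (auto simp: differentiable_def)
qed

lemma Cinf_on_imp_continuous_on: "Cinf_on S f \<Longrightarrow> continuous_on S f"
  unfolding Cinf_on_def using Ck_on.simps(1) by blast

lemma hol_on_imp_continuous_on: "hol_on S f \<Longrightarrow> continuous_on S f"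
  unfolding hol_on_def by (meson continuous_at_imp_continuous_on has_derivative_continuous)

section \<open>Charts\<close>

locale atlas =
  fixes A :: "('a::t2_space, 'n::finite) chart set"
  assumes complex_atlas: "complex_atlas A"
begin

lemma chart_covers: obtains c where "c \<in> A" "p \<in> fst c"
  using complex_atlas unfolding complex_atlas_def by blast

lemma
  assumes "c \<in> A"
  shows open_chart: "open (fst c)" and open_chart_image: "open (snd c ` fst c)"
    and chart_homeomorphism: "homeomorphism (fst c) (snd c ` fst c) (snd c) (chart_inv c)"
  using assms complex_atlas unfolding complex_atlas_def by blast+

lemma chart_inv_chart: "c \<in> A \<Longrightarrow> p \<in> fst c \<Longrightarrow> chart_inv c (snd c p) = p"
  using chart_homeomorphism homeomorphism_apply1 by blast

lemma continuous_on_of_charts: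
  assumes "open V" and "\<And>c. c \<in> A \<Longrightarrow> continuous_on (snd c ` (fst c \<inter> V)) (f \<circ> chart_inv c)"
  shows "continuous_on V f"
proof (rule continuous_at_imp_continuous_on, rule ballI)
  fix p assume p: "p \<in> V"
  obtain c where c: "c \<in> A" "p \<in> fst c" by (rule chart_covers)
  have "continuous_on (fst c \<inter> V) ((f \<circ> chart_inv c) \<circ> snd c)"
  proof (rule continuous_on_compose)
    show "continuous_on (fst c \<inter> V) (snd c)"
      using homeomorphism_cont1[OF chart_homeomorphism[OF c(1)]]
      by (rule continuous_on_subset) auto
  qed (rule assms(2)[OF c(1)])
  then have "continuous_on (fst c \<inter> V) f"
    by (rule continuous_on_eq) (simp add: chart_inv_chart c)
  then show "isCont f p"
    using continuous_on_eq_continuous_at[of "fst c \<inter> V" f] open_chart[OF c(1)] assms(1) c p by auto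
qed

lemma smooth_on_mfd_imp_continuous_on:
  "open V \<Longrightarrow> smooth_on_mfd A V f \<Longrightarrow> continuous_on V f"
  unfolding smooth_on_mfd_def
  by (intro continuous_on_of_charts Cinf_on_imp_continuous_on) simp_all

lemma hol_on_mfd_imp_continuous_on:
  "open V \<Longrightarrow> hol_on_mfd A V f \<Longrightarrow> continuous_on V f"
  unfolding hol_on_mfd_def
  by (intro continuous_on_of_charts hol_on_imp_continuous_on) simp_all

lemma smooth_fun_imp_continuous_on: "f \<in> smooth_fun A \<Longrightarrow> continuous_on UNIV f"
  by (rule smooth_on_mfd_imp_continuous_on) (auto simp: smooth_fun_def)

lemma smooth_fun_const: "(\<lambda>_. c) \<in> smooth_fun A"
  by (simp add: smooth_fun_def smooth_on_mfd_def Cinf_on_def comp_def Ck_on_const)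

lemma smooth_fun_add: "f \<in> smooth_fun A \<Longrightarrow> g \<in> smooth_fun A \<Longrightarrow> f + g \<in> smooth_fun A"
  by (auto simp: smooth_fun_def smooth_on_mfd_def Cinf_on_def comp_def
      intro!: Ck_on_add open_chart_image)

lemma smooth_fun_mult: "f \<in> smooth_fun A \<Longrightarrow> g \<in> smooth_fun A \<Longrightarrow> f * g \<in> smooth_fun A"
  by (auto simp: smooth_fun_def smooth_on_mfd_def Cinf_on_def comp_def
      intro!: Ck_on_mult open_chart_image)

lemma smooth_fun_scale: "f \<in> smooth_fun A \<Longrightarrow> (\<lambda>q. c * f q) \<in> smooth_fun A"
  using smooth_fun_mult[OF smooth_fun_const, of f c] by (simp add: times_fun_def)

section \<open>Coordinate vectors\<close>

context
  fixes c p
  assumes c: "c \<in> A" and p: "p \<in> fst c"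
begin

lemma smooth_fun_has_derivative:
  assumes "f \<in> smooth_fun A"
  shows "((f \<circ> chart_inv c) has_derivative frechet_derivative (f \<circ> chart_inv c) (at (snd c p)))
    (at (snd c p))"
proof -
  have "Ck_on (Suc 0) (snd c ` fst c) (f \<circ> chart_inv c)"
    using assms c unfolding smooth_fun_def smooth_on_mfd_def Cinf_on_def by (simp del: Ck_on.simps)
  then show ?thesis using p by (intro iffD1[OF frechet_derivative_works]) auto
qed

text \<open>\<open>smooth_form2\<close> grants bilinearity and skewness on
  \<open>tangent A p\<close> only, so coordinate vectors must be recognized as derivations before
  the form can be computed on them.\<close>

lemma coord_vec_tangent: "coord_vec A c p w \<in> tangent A p"
proof -
  let ?z = "snd c p" and ?D = "\<lambda>f. frechet_derivative (f \<circ> chart_inv c) (at (snd c p))"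
  have "?D (f + g) = (\<lambda>w. ?D f w + ?D g w)" if "f \<in> smooth_fun A" "g \<in> smooth_fun A" for f g
    using has_derivative_add[OF that[THEN smooth_fun_has_derivative]]
    by (intro frechet_derivative_at[symmetric]) (simp add: comp_def)
  moreover have "?D (f * g) = (\<lambda>w. f p * ?D g w + ?D f w * g p)"
    if "f \<in> smooth_fun A" "g \<in> smooth_fun A" for f g
    using has_derivative_mult[OF that[THEN smooth_fun_has_derivative]] chart_inv_chart[OF c p]
    by (intro frechet_derivative_at[symmetric]) (simp add: comp_def)
  moreover have "?D (\<lambda>q. a * f q) = (\<lambda>w. a * ?D f w)" if "f \<in> smooth_fun A" for f a
    using has_derivative_mult_right[OF smooth_fun_has_derivative[OF that], of a]
    by (intro frechet_derivative_at[symmetric]) (simp add: comp_def)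
  ultimately show ?thesis
    by (auto simp: tangent_def coord_vec_def smooth_fun_add smooth_fun_mult smooth_fun_scale algebra_simps)
qed

text \<open>The coefficients 1, and the summand with coefficient 0 in the next lemma, give the
  literal shape of a combination in \<open>smooth_form2\<close>.\<close>

lemma coord_vec_add:
  "coord_vec A c p (w + w') = (\<lambda>f. 1 * coord_vec A c p w f + 1 * coord_vec A c p w' f)"
  using linear_add[OF has_derivative_linear[OF smooth_fun_has_derivative]]
  by (auto simp: coord_vec_def fun_eq_iff)

lemma coord_vec_scaleR:
  "coord_vec A c p (r *\<^sub>R w) = (\<lambda>f. of_real r * coord_vec A c p w f + 0 * coord_vec A c p w f)"
  using linear_scale[OF has_derivative_linear[OF smooth_fun_has_derivative]]
  by (auto simp: coord_vec_def fun_eq_iff scaleR_conv_of_real)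

end

end

section \<open>Partitions of unity\<close>

locale compact_atlas = atlas A for A :: "('a::t2_space, 'n::finite) chart set" +
  assumes compact_UNIV: "compact (UNIV :: 'a set)"
begin

text \<open>\<open>chart_partition\<close> asks for continuity, so a tent function of the distance
  in a chart suffices. Its extension by 0 is continuous because \<open>K\<close>, being compact in a
  Hausdorff space, is closed: \<open>fst c\<close> and \<open>- K\<close> are then two open sets
  that cover everything, and on each of them the function is continuous.\<close>

lemma bump_function:
  "\<exists>c \<beta>. c \<in> A \<and> continuous_on UNIV \<beta> \<and> (\<forall>q. 0 \<le> \<beta> q) \<and>
     (\<exists>K. compact K \<and> K \<subseteq> fst c \<and> (\<forall>q. q \<notin> K \<longrightarrow> \<beta> q = 0)) \<and> (0::real) < \<beta> p"
proof -
  obtain c where c: "c \<in> A" "p \<in> fst c" by (rule chart_covers)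
  note hom = chart_homeomorphism[OF c(1)]
  obtain r where r: "r > 0" "cball (snd c p) r \<subseteq> snd c ` fst c"
    using open_chart_image[OF c(1)] c(2) by (auto simp: open_contains_cball)
  define K where "K = chart_inv c ` cball (snd c p) r"
  define \<beta> where "\<beta> q = (if q \<in> fst c then max 0 (r - dist (snd c q) (snd c p)) else 0)" for q
  have K: "compact K" "K \<subseteq> fst c"
    unfolding K_def using hom r
    by (auto simp: homeomorphism_def intro!: compact_continuous_image intro: continuous_on_subset)
  have zero: "\<beta> q = 0" if "q \<notin> K" for q
  proof (cases "q \<in> fst c")
    case True
    then have "snd c q \<notin> cball (snd c p) r"
      using that chart_inv_chart[OF c(1)] unfolding K_def by (metis imageI)
    then show ?thesis by (simp add: \<beta>_def dist_commute)
  qed (simp add: \<beta>_def)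
  have "continuous_on (fst c) (\<lambda>q. max 0 (r - dist (snd c q) (snd c p)))"
    using hom by (intro continuous_intros) (auto simp: homeomorphism_def)
  then have "continuous_on (fst c) \<beta>" by (rule continuous_on_eq) (simp add: \<beta>_def)
  moreover have "continuous_on (- K) \<beta>"
    by (rule continuous_on_eq[of _ "\<lambda>_. 0"]) (auto simp: zero)
  ultimately have "continuous_on (fst c \<union> - K) \<beta>"
    using K open_chart[OF c(1)] by (intro continuous_on_open_Un) (auto intro: compact_imp_closed)
  moreover have "fst c \<union> - K = UNIV" using K by auto
  ultimately show ?thesis
    using c K zero r(1)
    by (intro exI[of _ c] exI[of _ \<beta>] conjI exI[of _ K]) (auto simp: \<beta>_def)
qed

text \<open>This makes the choice in \<open>liouville_integral\<close> a genuine partition. By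
  compactness finitely many bumps have a sum that is positive everywhere, and division by it
  normalizes them.\<close>

lemma chart_partition_exists: "\<exists>k c \<rho>. chart_partition A k c \<rho>"
proof -
  obtain c \<beta> where c: "\<And>p. c p \<in> A" and cont: "\<And>p. continuous_on UNIV (\<beta> p)"
    and nonneg: "\<And>p q. 0 \<le> \<beta> p q"
    and supp: "\<And>p. \<exists>K. compact K \<and> K \<subseteq> fst (c p) \<and> (\<forall>q. q \<notin> K \<longrightarrow> \<beta> p q = 0)"
    and pos: "\<And>p. (0::real) < \<beta> p p"
    using bump_function by metis
  have "open {q. 0 < \<beta> p q}" for p
    using cont[of p] by (intro open_Collect_less continuous_on_const)
  moreover have "UNIV \<subseteq> (\<Union>p\<in>UNIV. {q. 0 < \<beta> p q})" using pos by auto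
  ultimately obtain T where T: "finite T" "UNIV \<subseteq> (\<Union>p\<in>T. {q. 0 < \<beta> p q})"
    using compactE_image[OF compact_UNIV, of UNIV "\<lambda>p. {q. 0 < \<beta> p q}"] by metis
  define s where "s q = (\<Sum>p\<in>T. \<beta> p q)" for q
  have s: "s q > 0" for q
  proof -
    obtain p where "p \<in> T" "0 < \<beta> p q" using T(2) by auto
    then show ?thesis unfolding s_def using T(1) nonneg by (intro sum_pos2)
  qed
  have s_cont: "continuous_on UNIV s" unfolding s_def by (intro continuous_on_sum cont)
  obtain e where e: "bij_betw e {..<card T} T"
    using ex_bij_betw_nat_finite[OF T(1)] by (auto simp: atLeast0LessThan)
  define \<rho> where "\<rho> l q = \<beta> (e l) q / s q" for l q
  have "chart_partition A (card T) (c \<circ> e) \<rho>"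
    unfolding chart_partition_def
  proof (intro conjI allI impI)
    fix l
    show "(c \<circ> e) l \<in> A" using c by simp
    show "continuous_on UNIV (\<rho> l)"
      unfolding \<rho>_def using s by (intro continuous_on_divide cont s_cont) (metis less_irrefl)
    show "0 \<le> \<rho> l q" for q unfolding \<rho>_def using nonneg s[of q] by (simp add: less_imp_le)
    show "\<exists>K. compact K \<and> K \<subseteq> fst ((c \<circ> e) l) \<and> (\<forall>q. q \<notin> K \<longrightarrow> \<rho> l q = 0)"
      using supp[of "e l"] by (auto simp: \<rho>_def)
  next
    fix q
    have "(\<Sum>l<card T. \<rho> l q) = (\<Sum>p\<in>T. \<beta> p q / s q)"
      unfolding \<rho>_def by (rule sum.reindex_bij_betw[OF e])
    also have "\<dots> = 1" using s[of q] by (simp add: s_def flip: sum_divide_distrib)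
    finally show "(\<Sum>l<card T. \<rho> l q) = 1" .
  qed
  then show ?thesis by blast
qed

end

section \<open>The Liouville integral\<close>

locale compact_kaehler = compact_atlas A
  for A :: "('a::t2_space, 'n::finite) chart set" +
  fixes \<omega> :: "'a form2"
  assumes kaehler_form: "kaehler_form A \<omega>"
begin

text \<open>Taking the real part loses nothing, as the Kaehler form is real on coordinate vectors of
  a chart.\<close>

definition real_form :: "('a, 'n) chart \<Rightarrow> 'a \<Rightarrow> complex ^ 'n \<Rightarrow> complex ^ 'n \<Rightarrow> real" where
  "real_form c p u v = Re (\<omega> p (coord_vec A c p u) (coord_vec A c p v))"

context
  fixes c p
  assumes c: "c \<in> A" and p: "p \<in> fst c"
begin

lemma form_eq_real_form:
  "\<omega> p (coord_vec A c p u) (coord_vec A c p v) = of_real (real_form c p u v)"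
proof -
  have "\<omega> p (coord_vec A c p u) (coord_vec A c p v) \<in> \<real>"
    using kaehler_form c p unfolding kaehler_form_def by blast
  then show ?thesis by (simp add: real_form_def)
qed

lemma form_combination:
  "\<omega> p (\<lambda>f. a * coord_vec A c p u f + b * coord_vec A c p v f) (coord_vec A c p w) =
    a * \<omega> p (coord_vec A c p u) (coord_vec A c p w) + b * \<omega> p (coord_vec A c p v) (coord_vec A c p w)"
  using kaehler_form coord_vec_tangent[OF c p] unfolding kaehler_form_def smooth_form2_def by blast

lemma form_skew:
  "\<omega> p (coord_vec A c p u) (coord_vec A c p v) = - \<omega> p (coord_vec A c p v) (coord_vec A c p u)"
  using kaehler_form coord_vec_tangent[OF c p] unfolding kaehler_form_def smooth_form2_def by blast

lemma positive_real_form: "positive_skew_form (real_form c p)"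
proof (intro positive_skew_form.intro skew_form.intro positive_skew_form_axioms.intro)
  show "linear (\<lambda>u. real_form c p u w)" for w
    by (rule linearI)
      (simp_all only: real_form_def coord_vec_add[OF c p] coord_vec_scaleR[OF c p] form_combination,
        simp_all)
  show "real_form c p u v = - real_form c p v u" for u v
    unfolding real_form_def by (subst form_skew) simp
  show "real_form c p (\<i> *s u) (\<i> *s v) = real_form c p u v" for u v
  proof -
    have "\<omega> p (coord_vec A c p (\<i> *s u)) (coord_vec A c p (\<i> *s v)) =
        \<omega> p (coord_vec A c p u) (coord_vec A c p v)"
      using kaehler_form c p unfolding kaehler_form_def by blast
    then show ?thesis by (simp add: real_form_def)
  qed
  show "real_form c p v (\<i> *s v) > 0" if "v \<noteq> 0" for v
    using kaehler_form c p that unfolding kaehler_form_def real_form_def by blast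
qed

text \<open>\<open>real_frame\<close> is the complex frame of the standard basis, so the density is
  the Pfaffian shown to be positive above, divided by \<open>2^n n!\<close>.\<close>

lemma liouville_density_pos:
  "\<exists>r>0. liouville_density A \<omega> c p = of_real r"
proof -
  interpret positive_skew_form "real_form c p" by (rule positive_real_form)
  have frame: "real_frame = complex_frame (\<lambda>j::'n. axis j 1)"
    by (auto simp: fun_eq_iff real_frame_def complex_frame_def vec_eq_iff axis_def)
  define r where "r = pfaffian (real_frame :: 'n \<times> bool \<Rightarrow> _) / (2 ^ CARD('n) * fact CARD('n))"
  have "r > 0" unfolding r_def frame using pfaffian_real_frame_pos by simp
  moreover have "liouville_density A \<omega> c p = of_real r"
    by (simp add: liouville_density_def form_eq_real_form r_def pfaffian_def)
  ultimately show ?thesis by blast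
qed

end

section \<open>Continuity, integrability and positivity in a chart\<close>

lemma liouville_density_continuous:
  assumes c: "c \<in> A"
  shows "continuous_on (fst c) (liouville_density A \<omega> c)"
proof -
  have "continuous_on (fst c) (\<lambda>p. \<omega> p (coord_vec A c p u) (coord_vec A c p v))" for u v
    using kaehler_form c open_chart[OF c] unfolding kaehler_form_def smooth_form2_def
    by (blast intro: smooth_on_mfd_imp_continuous_on)
  then show ?thesis
    unfolding liouville_density_def
    by (intro continuous_on_divide continuous_on_sum continuous_on_mult continuous_on_prod
        continuous_on_const) auto
qed

text \<open>A continuous function on the open image of a chart may fail to be integrable; the
  compact support \<open>K\<close> reduces the integral to a compact set.\<close>

lemma chart_integrable:
  fixes g :: "'a \<Rightarrow> 'b::{banach, second_countable_topology}"
  assumes c: "c \<in> A" and g: "continuous_on (fst c) g"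
    and K: "compact K" "K \<subseteq> fst c" "\<And>p. p \<notin> K \<Longrightarrow> g p = 0"
  shows "set_integrable lborel (snd c ` fst c) (\<lambda>z. g (chart_inv c z))"
proof -
  note hom = chart_homeomorphism[OF c]
  have K': "compact (snd c ` K)"
    using K hom by (intro compact_continuous_image) (auto simp: homeomorphism_def intro: continuous_on_subset)
  have "continuous_on (snd c ` K) (\<lambda>z. g (chart_inv c z))"
  proof (rule continuous_on_compose2[of "fst c" g])
    show "continuous_on (snd c ` K) (chart_inv c)"
      using K(2) by (intro continuous_on_subset[OF homeomorphism_cont2[OF hom]]) auto
    show "chart_inv c ` snd c ` K \<subseteq> fst c"
      using K(2) chart_inv_chart[OF c] by (auto simp: subset_iff)
  qed (rule g)
  then have "integrable lborel (\<lambda>z. indicator (snd c ` K) z *\<^sub>R g (chart_inv c z))"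
    by (rule borel_integrable_compact[OF K'])
  moreover have "indicator (snd c ` K) z *\<^sub>R g (chart_inv c z) =
      indicator (snd c ` fst c) z *\<^sub>R g (chart_inv c z)" for z
  proof (cases "z \<in> snd c ` K")
    case True
    with K(2) have "z \<in> snd c ` fst c" by auto
    with True show ?thesis by simp
  next
    case False
    show ?thesis
    proof (cases "z \<in> snd c ` fst c")
      case True
      then obtain q where q: "q \<in> fst c" "z = snd c q" by auto
      with False have "q \<notin> K" by auto
      then show ?thesis using q K(3) chart_inv_chart[OF c] by simp
    qed (use False in simp)
  qed
  ultimately show ?thesis by (simp add: set_integrable_def)
qed

lemma set_integral_nonneg:
  fixes w :: "'v \<Rightarrow> real"
  assumes "\<And>z. z \<in> S \<Longrightarrow> 0 \<le> w z"
  shows "0 \<le> (LINT z:S|M. w z)"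
  unfolding set_lebesgue_integral_def
  by (rule Bochner_Integration.integral_nonneg) (simp add: assms indicator_def)

text \<open>A vanishing integral would make \<open>w\<close> zero almost everywhere, but the set
  where \<open>w\<close> is positive is open and contains \<open>x\<close>, hence is not
  negligible.\<close>

lemma set_integral_pos:
  fixes w :: "'v::euclidean_space \<Rightarrow> real"
  assumes "open S" "continuous_on S w" "set_integrable lborel S w"
    and nonneg: "\<And>z. z \<in> S \<Longrightarrow> 0 \<le> w z" and x: "x \<in> S" "0 < w x"
  shows "0 < (LINT z:S|lborel. w z)"
proof -
  have ge: "0 \<le> (LINT z:S|lborel. w z)"
    using nonneg by (rule set_integral_nonneg)
  have "(LINT z:S|lborel. w z) \<noteq> 0"
  proof
    assume "(LINT z:S|lborel. w z) = 0"
    then have "AE z in lborel. indicator S z *\<^sub>R w z = 0"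
      using assms(3) nonneg
      by (subst (asm) set_lebesgue_integral_def, subst (asm) integral_nonneg_eq_0_iff_AE)
        (auto simp: set_integrable_def indicator_def)
    moreover define U where "U = {z \<in> S. 0 < w z}"
    ultimately have "AE z in lborel. z \<notin> U" by (auto simp: indicator_def elim: eventually_mono)
    moreover have U: "open U"
    proof -
      have "open (S \<inter> w -` {0<..})"
        using assms(1,2) by (intro continuous_open_preimage) auto
      moreover have "U = S \<inter> w -` {0<..}" by (auto simp: U_def)
      ultimately show ?thesis by simp
    qed
    ultimately have "U \<in> null_sets lborel"
      by (simp add: AE_iff_null_sets borel_open)
    then have "negligible U"
      by (simp add: negligible_iff_null_sets null_sets_completionI)
    then show False using open_not_negligible[OF U] x by (auto simp: U_def)
  qed
  with ge show ?thesis by simp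
qed

text \<open>The chosen partition is the same for all \<open>f\<close>, so integrals of different
  functions can be compared chart by chart.\<close>

definition integration_partition ::
  "nat \<Rightarrow> (nat \<Rightarrow> ('a, 'n) chart) \<Rightarrow> (nat \<Rightarrow> 'a \<Rightarrow> real) \<Rightarrow> bool" where
  "integration_partition k c \<rho> \<longleftrightarrow> chart_partition A k c \<rho> \<and>
    (\<forall>f. liouville_integral A \<omega> f =
      (\<Sum>l<k. LINT z : snd (c l) ` fst (c l) | lborel.
        of_real (\<rho> l (chart_inv (c l) z)) * f (chart_inv (c l) z) *
        liouville_density A \<omega> (c l) (chart_inv (c l) z)))"

lemma integration_partition_exists:
  obtains k c \<rho> where "integration_partition k c \<rho>"
proof -
  obtain k c \<rho> where some: "(SOME (k, c, \<rho>). chart_partition A k c \<rho>) = (k, c, \<rho>)"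
    by (rule prod_cases3)
  have "\<exists>x. case x of (k, c, \<rho>) \<Rightarrow> chart_partition A k c \<rho>" using chart_partition_exists by auto
  from someI_ex[OF this] have "chart_partition A k c \<rho>" by (simp add: some)
  then have "integration_partition k c \<rho>"
    unfolding integration_partition_def liouville_integral_def some by (simp add: Let_def)
  then show ?thesis by (rule that)
qed

lemma liouville_integrable:
  assumes P: "chart_partition A k c \<rho>" and l: "l < k" and f: "continuous_on UNIV f"
  shows "set_integrable lborel (snd (c l) ` fst (c l))
    (\<lambda>z. of_real (\<rho> l (chart_inv (c l) z)) * f (chart_inv (c l) z) *
        liouville_density A \<omega> (c l) (chart_inv (c l) z))"
proof -
  obtain K where K: "compact K" "K \<subseteq> fst (c l)" "\<And>p. p \<notin> K \<Longrightarrow> \<rho> l p = 0"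
    using P l unfolding chart_partition_def by blast
  have c: "c l \<in> A" and \<rho>: "continuous_on UNIV (\<rho> l)" using P l unfolding chart_partition_def by auto
  have "continuous_on (fst (c l)) (\<lambda>p. of_real (\<rho> l p) * f p * liouville_density A \<omega> (c l) p)"
    by (intro continuous_on_mult continuous_on_of_real liouville_density_continuous c
        continuous_on_subset[OF \<rho>] continuous_on_subset[OF f] subset_UNIV)
  from chart_integrable[OF c this K(1,2)] K(3) show ?thesis by simp
qed

lemma liouville_integral_add:
  assumes "continuous_on UNIV f" "continuous_on UNIV g"
  shows "liouville_integral A \<omega> (\<lambda>p. f p + g p) = liouville_integral A \<omega> f + liouville_integral A \<omega> g"
proof -
  obtain k c \<rho> where part: "integration_partition k c \<rho>"
    by (rule integration_partition_exists)
  then have P: "chart_partition A k c \<rho>" by (simp add: integration_partition_def)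
  note eq = part[unfolded integration_partition_def, THEN conjunct2, rule_format]
  show ?thesis
    unfolding eq sum.distrib[symmetric]
  proof (rule sum.cong)
    fix l assume "l \<in> {..<k}"
    then have l: "l < k" by simp
    show "(LINT z : snd (c l) ` fst (c l) | lborel. of_real (\<rho> l (chart_inv (c l) z)) *
        (f (chart_inv (c l) z) + g (chart_inv (c l) z)) *
        liouville_density A \<omega> (c l) (chart_inv (c l) z)) =
      (LINT z : snd (c l) ` fst (c l) | lborel. of_real (\<rho> l (chart_inv (c l) z)) *
        f (chart_inv (c l) z) * liouville_density A \<omega> (c l) (chart_inv (c l) z)) +
      (LINT z : snd (c l) ` fst (c l) | lborel. of_real (\<rho> l (chart_inv (c l) z)) *
        g (chart_inv (c l) z) * liouville_density A \<omega> (c l) (chart_inv (c l) z))"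
      using set_integral_add(2)[OF liouville_integrable[OF P l assms(1)] liouville_integrable[OF P l assms(2)]]
      by (simp add: distrib_left distrib_right)
  qed simp
qed

lemma liouville_integral_mult_left:
  "liouville_integral A \<omega> (\<lambda>p. a * f p) = a * liouville_integral A \<omega> f"
proof -
  obtain k c \<rho> where part: "integration_partition k c \<rho>"
    by (rule integration_partition_exists)
  note eq = part[unfolded integration_partition_def, THEN conjunct2, rule_format]
  show ?thesis
    unfolding eq sum_distrib_left set_integral_mult_right[symmetric]
    by (simp add: mult_ac)
qed

text \<open>The weights \<rho> and the density are real, so conjugation reaches \<open>f\<close>
  alone. Outside the chart image the indicator is 0, which disposes of points where the density is
  not under control.\<close>

lemma liouville_integral_cnj:
  "liouville_integral A \<omega> (\<lambda>p. cnj (f p)) = cnj (liouville_integral A \<omega> f)"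
proof -
  obtain k c \<rho> where part: "integration_partition k c \<rho>"
    by (rule integration_partition_exists)
  then have P: "chart_partition A k c \<rho>" by (simp add: integration_partition_def)
  note eq = part[unfolded integration_partition_def, THEN conjunct2, rule_format]
  show ?thesis
    unfolding eq cnj_sum set_lebesgue_integral_def
      Bochner_Integration.integral_cnj[symmetric]
  proof (rule sum.cong[OF refl], rule Bochner_Integration.integral_cong[OF refl])
    fix l z assume l: "l \<in> {..<k}"
    let ?q = "chart_inv (c l) z"
    show "indicator (snd (c l) ` fst (c l)) z *\<^sub>R (of_real (\<rho> l ?q) * cnj (f ?q) *
          liouville_density A \<omega> (c l) ?q) =
        cnj (indicator (snd (c l) ` fst (c l)) z *\<^sub>R (of_real (\<rho> l ?q) * f ?q *
          liouville_density A \<omega> (c l) ?q))"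
    proof (cases "z \<in> snd (c l) ` fst (c l)")
      case True
      have c: "c l \<in> A" using P l unfolding chart_partition_def by auto
      have "?q \<in> fst (c l)" using True chart_inv_chart[OF c] by auto
      then show ?thesis using liouville_density_pos[OF c, of ?q] by auto
    qed simp
  qed
qed

text \<open>The partition sums to 1 at \<open>p\<close>, so some chart has a positive weight there;
  its integral is positive and all others are nonnegative.\<close>

lemma liouville_integral_pos:
  assumes g: "continuous_on UNIV g" and nonneg: "\<And>p. 0 \<le> g p" and p: "0 < g p"
  shows "0 < Re (liouville_integral A \<omega> (\<lambda>p. of_real (g p)))"
proof -
  obtain k c \<rho> where part: "integration_partition k c \<rho>"
    by (rule integration_partition_exists)
  then have P: "chart_partition A k c \<rho>" by (simp add: integration_partition_def)
  note eq = part[unfolded integration_partition_def, THEN conjunct2, rule_format]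
  define w where "w l q = \<rho> l q * g q * Re (liouville_density A \<omega> (c l) q)" for l q
  let ?S = "\<lambda>l. snd (c l) ` fst (c l)"
  have c: "c l \<in> A" if "l < k" for l using P that unfolding chart_partition_def by auto
  have \<rho>: "0 \<le> \<rho> l q" if "l < k" for l q using P that unfolding chart_partition_def by auto
  have inv: "chart_inv (c l) z \<in> fst (c l)" if "l < k" "z \<in> ?S l" for l z
    using that chart_inv_chart[OF c] by auto
  have dens: "0 < Re (liouville_density A \<omega> (c l) q)"
      "liouville_density A \<omega> (c l) q = of_real (Re (liouville_density A \<omega> (c l) q))"
    if "l < k" "q \<in> fst (c l)" for l q
    using liouville_density_pos[OF c[OF that(1)] that(2)] by auto
  have w_nonneg: "0 \<le> w l (chart_inv (c l) z)" if "l < k" "z \<in> ?S l" for l z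
    unfolding w_def using \<rho>[OF that(1)] nonneg dens(1)[OF that(1) inv[OF that]]
    by (intro mult_nonneg_nonneg) auto
  have w_cont: "continuous_on (fst (c l)) (w l)" if "l < k" for l
    unfolding w_def using P that
    by (intro continuous_on_mult continuous_on_Re liouville_density_continuous c
        continuous_on_subset[OF g]) (auto simp: chart_partition_def intro: continuous_on_subset)
  have w_int: "set_integrable lborel (?S l) (\<lambda>z. w l (chart_inv (c l) z))" if l: "l < k" for l
  proof -
    obtain K where "compact K" "K \<subseteq> fst (c l)" "\<And>p. p \<notin> K \<Longrightarrow> \<rho> l p = 0"
      using P l unfolding chart_partition_def by blast
    then show ?thesis by (intro chart_integrable[OF c[OF l] w_cont[OF l], of K]) (auto simp: w_def)
  qed
  have "Re (liouville_integral A \<omega> (\<lambda>p. of_real (g p))) =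
      (\<Sum>l<k. LINT z:?S l|lborel. w l (chart_inv (c l) z))"
    unfolding eq Re_sum
  proof (rule sum.cong)
    fix l assume l: "l \<in> {..<k}"
    have "(LINT z:?S l|lborel. of_real (\<rho> l (chart_inv (c l) z)) * of_real (g (chart_inv (c l) z)) *
        liouville_density A \<omega> (c l) (chart_inv (c l) z)) =
        (LINT z:?S l|lborel. complex_of_real (w l (chart_inv (c l) z)))"
      unfolding set_lebesgue_integral_def
    proof (rule Bochner_Integration.integral_cong)
      fix z
      let ?q = "chart_inv (c l) z"
      show "indicator (?S l) z *\<^sub>R (of_real (\<rho> l ?q) * of_real (g ?q) *
          liouville_density A \<omega> (c l) ?q) = indicator (?S l) z *\<^sub>R complex_of_real (w l ?q)"
      proof (cases "z \<in> ?S l")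
        case True
        then show ?thesis using l dens(2)[OF _ inv[OF _ True]] by (simp add: w_def) 
      qed simp
    qed simp
    then show "Re (LINT z:?S l|lborel. of_real (\<rho> l (chart_inv (c l) z)) *
        of_real (g (chart_inv (c l) z)) * liouville_density A \<omega> (c l) (chart_inv (c l) z)) =
        (LINT z:?S l|lborel. w l (chart_inv (c l) z))"
      by (simp only: set_integral_complex_of_real Re_complex_of_real)
  qed simp
  moreover have "0 < (\<Sum>l<k. LINT z:?S l|lborel. w l (chart_inv (c l) z))"
  proof -
    have "(\<Sum>l<k. \<rho> l p) \<noteq> 0" using P unfolding chart_partition_def by simp
    then obtain l where l: "l < k" "\<rho> l p \<noteq> 0" by (meson lessThan_iff sum.neutral)
    then have pl: "p \<in> fst (c l)" using P unfolding chart_partition_def by blast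
    have "0 < (LINT z:?S l|lborel. w l (chart_inv (c l) z))"
    proof (rule set_integral_pos[where x = "snd (c l) p"])
      show "continuous_on (?S l) (\<lambda>z. w l (chart_inv (c l) z))"
        by (rule continuous_on_compose2[OF w_cont[OF l(1)]])
          (use chart_homeomorphism[OF c[OF l(1)]] in \<open>auto simp: homeomorphism_def\<close>)
      have "0 < w l p"
        unfolding w_def using \<rho>[OF l(1), of p] l(2) p dens(1)[OF l(1) pl] by simp
      then show "0 < w l (chart_inv (c l) (snd (c l) p))"
        using chart_inv_chart[OF c[OF l(1)] pl] by simp
    qed (use l(1) pl open_chart_image[OF c] w_int w_nonneg in auto)
    moreover have "0 \<le> (LINT z:?S l|lborel. w l (chart_inv (c l) z))" if "l < k" for l
      using w_nonneg[OF that] by (rule set_integral_nonneg)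
    ultimately show ?thesis using l(1) by (intro sum_pos2[of _ l]) auto
  qed
  ultimately show ?thesis by simp
qed

end

section \<open>Sections of Hermitian line bundles\<close>

text \<open>Large enough to be preserved by multiplication with smooth functions, small enough for a
  nonzero section to have positive square norm.\<close>

definition cont_sections :: "('i, 'a::topological_space) line_bundle \<Rightarrow> ('i, 'a) bsection set" where
  "cont_sections L = {s \<in> sections L. \<forall>i. continuous_on (patch L i) (s i)}"

text \<open>The topological content of a Hermitian metric on a line bundle, in a form that passes to
  \<open>L^m\<close> and its induced metric.\<close>

definition continuous_hermitian ::
  "('i, 'a::topological_space) line_bundle \<Rightarrow> ('i, 'a) metric \<Rightarrow> bool" where
  "continuous_hermitian L h \<longleftrightarrow>
     (\<forall>i. open (patch L i)) \<and> (\<Union>i. patch L i) = UNIV \<and>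
     (\<forall>i. continuous_on (patch L i) (h i)) \<and> (\<forall>i. \<forall>p\<in>patch L i. h i p > 0) \<and>
     (\<forall>i j. \<forall>p\<in>patch L i \<inter> patch L j. h j p = h i p * (cmod (transition L i j p))\<^sup>2)"

lemma sectionsI:
  assumes "\<And>i p. p \<notin> patch L i \<Longrightarrow> s i p = 0"
    and "\<And>i j p. p \<in> patch L i \<Longrightarrow> p \<in> patch L j \<Longrightarrow> s i p = transition L i j p * s j p"
  shows "s \<in> sections L"
  using assms unfolding sections_def by blast

lemma sections_outside: "s \<in> sections L \<Longrightarrow> p \<notin> patch L i \<Longrightarrow> s i p = 0"
  unfolding sections_def by blast

lemma sections_transition:
  "s \<in> sections L \<Longrightarrow> p \<in> patch L i \<Longrightarrow> p \<in> patch L j \<Longrightarrow> s i p = transition L i j p * s j p"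
  unfolding sections_def by blast

lemma sections_zero: "0 \<in> sections L"
  by (rule sectionsI) simp_all

lemma sections_add:
  assumes "s \<in> sections L" "t \<in> sections L"
  shows "s + t \<in> sections L"
proof (rule sectionsI)
  fix i j p assume "p \<in> patch L i" "p \<in> patch L j"
  then show "(s + t) i p = transition L i j p * (s + t) j p"
    using sections_transition[OF assms(1), of p i j] sections_transition[OF assms(2), of p i j]
    by (simp only: plus_fun_apply distrib_left)
qed (simp add: sections_outside[OF assms(1)] sections_outside[OF assms(2)])

lemma sections_fun_scale:
  assumes "s \<in> sections L"
  shows "fun_scale f s \<in> sections L"
proof (rule sectionsI)
  fix i j p assume "p \<in> patch L i" "p \<in> patch L j"
  then show "fun_scale f s i p = transition L i j p * fun_scale f s j p"
    using sections_transition[OF assms, of p i j] by (simp only: fun_scale_def mult.left_commute)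
qed (simp add: fun_scale_def sections_outside[OF assms])

lemma sec_scale_eq_fun_scale: "sec_scale a s = fun_scale (\<lambda>_. a) s"
  by (simp add: sec_scale_def fun_scale_def)

lemma fun_scale_cont_sections:
  assumes "continuous_on UNIV f" "s \<in> cont_sections L"
  shows "fun_scale f s \<in> cont_sections L"
proof -
  have "continuous_on (patch L i) (\<lambda>p. f p * s i p)" for i
    using assms(2) continuous_on_subset[OF assms(1) subset_UNIV]
    by (intro continuous_on_mult) (simp_all add: cont_sections_def)
  then show ?thesis
    using assms(2) sections_fun_scale[of s L f] by (simp add: cont_sections_def fun_scale_def)
qed

lemma subspace_cont_sections: "sec.subspace (cont_sections L)"
proof (rule sec.subspaceI)
  show "0 \<in> cont_sections L"
    using sections_zero[of L] by (simp add: cont_sections_def zero_fun_def)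
  show "s + t \<in> cont_sections L" if "s \<in> cont_sections L" "t \<in> cont_sections L" for s t
    using that sections_add[of s L t] unfolding cont_sections_def
    by (simp add: plus_fun_def continuous_on_add)
  show "sec_scale a s \<in> cont_sections L" if "s \<in> cont_sections L" for a s
    unfolding sec_scale_eq_fun_scale using that by (intro fun_scale_cont_sections) auto
qed

lemma subspace_hol_sections:
  fixes A :: "('a::t2_space, 'n::finite) chart set"
  shows "sec.subspace (hol_sections A L)"
proof -
  have "hol_on S (\<lambda>z. f z + g z)" if "hol_on S f" "hol_on S g" for S and f g :: "complex ^ 'n \<Rightarrow> complex"
    unfolding hol_on_def
  proof
    fix z assume "z \<in> S"
    with that obtain D D' where D: "(f has_derivative D) (at z)" "\<forall>c w. D (c *s w) = c * D w"
      and D': "(g has_derivative D') (at z)" "\<forall>c w. D' (c *s w) = c * D' w"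
      unfolding hol_on_def by meson
    show "\<exists>D. ((\<lambda>z. f z + g z) has_derivative D) (at z) \<and> (\<forall>c w. D (c *s w) = c * D w)"
      by (rule exI[of _ "\<lambda>w. D w + D' w"])
        (simp add: has_derivative_add[OF D(1) D'(1)] D(2) D'(2) distrib_left)
  qed
  moreover have "hol_on S (\<lambda>z. a * f z)" if "hol_on S f" for S and f :: "complex ^ 'n \<Rightarrow> complex" and a
    unfolding hol_on_def
  proof
    fix z assume "z \<in> S"
    with that obtain D where D: "(f has_derivative D) (at z)" "\<forall>c w. D (c *s w) = c * D w"
      unfolding hol_on_def by meson
    show "\<exists>D. ((\<lambda>z. a * f z) has_derivative D) (at z) \<and> (\<forall>c w. D (c *s w) = c * D w)"
      by (rule exI[of _ "\<lambda>w. a * D w"])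
        (simp add: has_derivative_mult_right[OF D(1)] D(2) mult.left_commute)
  qed
  moreover have "hol_on S (\<lambda>z :: complex ^ 'n. 0)" for S
    unfolding hol_on_def by (intro ballI exI[of _ "\<lambda>w. 0"]) simp
  ultimately show ?thesis
    unfolding sec.subspace_def hol_sections_def hol_on_mfd_def
    using sections_zero[of L] sections_add[of _ L] sections_fun_scale[of _ L "\<lambda>_. a" for a]
    by (simp add: sec_scale_def fun_scale_def comp_def)
qed

lemma (in atlas) hol_sections_subset_cont_sections:
  assumes "\<And>i. open (patch L i)"
  shows "hol_sections A L \<subseteq> cont_sections L"
  unfolding hol_sections_def cont_sections_def
  using hol_on_mfd_imp_continuous_on[OF assms] by blast

text \<open>\<open>herm\<close> uses a frame picked by choice. Changing it multiplies both
  components by the transition function, and the resulting factor, its squared modulus, is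
  compensated by the weight.\<close>

lemma herm_eq:
  assumes H: "continuous_hermitian L h" and s: "s \<in> sections L" and t: "t \<in> sections L"
    and p: "p \<in> patch L i"
  shows "herm L h s t p = of_real (h i p) * cnj (s i p) * t i p"
proof -
  define j where "j = (SOME i. p \<in> patch L i)"
  have j: "p \<in> patch L j" unfolding j_def using p by (rule someI)
  have "s j p = transition L j i p * s i p" "t j p = transition L j i p * t i p"
    using sections_transition[OF s j p] sections_transition[OF t j p] .
  moreover have "h i p = h j p * (cmod (transition L j i p))\<^sup>2"
    using H p j unfolding continuous_hermitian_def by blast
  moreover have "complex_of_real ((cmod (transition L j i p))\<^sup>2) =
      transition L j i p * cnj (transition L j i p)"
    by (rule complex_norm_square)
  ultimately show ?thesis
    unfolding herm_def Let_def j_def[symmetric] by (simp only: of_real_mult complex_cnj_mult mult_ac)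
qed

lemma herm_continuous:
  fixes L :: "('i, 'a::t2_space) line_bundle"
  assumes H: "continuous_hermitian L h" and s: "s \<in> cont_sections L" and t: "t \<in> cont_sections L"
  shows "continuous_on UNIV (herm L h s t)"
proof (rule continuous_at_imp_continuous_on, rule ballI)
  fix p
  obtain i where p: "p \<in> patch L i" using H unfolding continuous_hermitian_def by blast
  have st: "s \<in> sections L" "t \<in> sections L" using s t by (auto simp: cont_sections_def)
  have "continuous_on (patch L i) (\<lambda>p. of_real (h i p) * cnj (s i p) * t i p)"
    using H s t unfolding continuous_hermitian_def cont_sections_def
    by (intro continuous_on_mult continuous_on_of_real continuous_on_cnj) blast+
  then have "continuous_on (patch L i) (herm L h s t)"
    by (rule continuous_on_eq) (simp add: herm_eq[OF H st])
  then show "isCont (herm L h s t) p"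
    using H p continuous_on_eq_continuous_at[of "patch L i"]
    unfolding continuous_hermitian_def by blast
qed

lemma (in compact_kaehler) hermitian_space_sections:
  assumes H: "continuous_hermitian L h"
  shows "hermitian_space sec_scale (cont_sections L) (sec_inner A \<omega> L h)"
proof -
  have cover: "\<exists>i. p \<in> patch L i" for p using H unfolding continuous_hermitian_def by blast
  have sec: "s \<in> sections L" if "s \<in> cont_sections L" for s
    using that by (simp add: cont_sections_def)
  note heq = herm_eq[OF H sec sec]
  show ?thesis
  proof (intro hermitian_space.intro hermitian_space_axioms.intro sec.vector_space_axioms subspace_cont_sections)
    fix u s t assume u: "u \<in> cont_sections L" and s: "s \<in> cont_sections L" and t: "t \<in> cont_sections L"
    have "herm L h u (s + t) = (\<lambda>p. herm L h u s p + herm L h u t p)"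
    proof
      fix p obtain i where "p \<in> patch L i" using cover by blast
      then show "herm L h u (s + t) p = herm L h u s p + herm L h u t p"
        using heq u s t sec.subspace_add[OF subspace_cont_sections s t] by (simp add: distrib_left)
    qed
    then show "sec_inner A \<omega> L h u (s + t) = sec_inner A \<omega> L h u s + sec_inner A \<omega> L h u t"
      unfolding sec_inner_def
      by (simp add: liouville_integral_add[OF herm_continuous[OF H u s] herm_continuous[OF H u t]])
  next
    fix u s a assume u: "u \<in> cont_sections L" and s: "s \<in> cont_sections L"
    have "herm L h u (sec_scale a s) = (\<lambda>p. a * herm L h u s p)"
    proof
      fix p obtain i where "p \<in> patch L i" using cover by blast
      then show "herm L h u (sec_scale a s) p = a * herm L h u s p"
        using heq u s sec.subspace_scale[OF subspace_cont_sections s] by (simp add: sec_scale_def)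
    qed
    then show "sec_inner A \<omega> L h u (sec_scale a s) = a * sec_inner A \<omega> L h u s"
      unfolding sec_inner_def by (simp add: liouville_integral_mult_left)
  next
    fix u s assume u: "u \<in> cont_sections L" and s: "s \<in> cont_sections L"
    have "herm L h s u = (\<lambda>p. cnj (herm L h u s p))"
    proof
      fix p obtain i where "p \<in> patch L i" using cover by blast
      then show "herm L h s u p = cnj (herm L h u s p)" using heq u s by simp
    qed
    then show "sec_inner A \<omega> L h s u = cnj (sec_inner A \<omega> L h u s)"
      unfolding sec_inner_def by (simp add: liouville_integral_cnj)
  next
    fix s assume s: "s \<in> cont_sections L" and "s \<noteq> 0"
    then obtain i p where nz: "s i p \<noteq> 0" by (auto simp: fun_eq_iff)
    have val: "herm L h s s p = of_real (h i p * (cmod (s i p))\<^sup>2)" if "p \<in> patch L i" for i p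
      using heq[OF s s that] complex_norm_square[of "s i p"] by (simp add: mult_ac)
    have h: "h i p > 0" if "p \<in> patch L i" for i p
      using H that unfolding continuous_hermitian_def by blast
    \<comment> \<open>Components are 0 off their patch, so a nonzero value locates
      \<open>p\<close>.\<close>
    have p: "p \<in> patch L i" using nz sections_outside[OF sec[OF s]] by blast
    have real: "herm L h s s q = of_real (Re (herm L h s s q))" "0 \<le> Re (herm L h s s q)" for q
    proof -
      obtain j where "q \<in> patch L j" using cover by blast
      with val[OF this] h[OF this]
      show "herm L h s s q = of_real (Re (herm L h s s q))" "0 \<le> Re (herm L h s s q)" by auto
    qed
    have "0 < Re (liouville_integral A \<omega> (\<lambda>q. of_real (Re (herm L h s s q))))"
    proof (rule liouville_integral_pos[of _ p])
      show "continuous_on UNIV (\<lambda>q. Re (herm L h s s q))"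
        by (rule continuous_on_Re[OF herm_continuous[OF H s s]])
      show "0 < Re (herm L h s s p)" using val[OF p] h[OF p] nz by simp
    qed (rule real(2))
    then show "0 < Re (sec_inner A \<omega> L h s s)" unfolding sec_inner_def using real(1) by simp
  qed
qed

section \<open>Toeplitz operators and their traces\<close>

text \<open>\<open>L\<close> and \<open>h\<close> stand here for \<open>L^m\<close> and its induced
  metric; \<open>toep\<close> and \<open>toep_norm\<close> are \<open>toeplitz\<close> and
  \<open>op_norm\<close> with the power already formed.\<close>

locale hermitian_bundle = compact_kaehler A \<omega>
  for A :: "('a::t2_space, 'n::finite) chart set" and \<omega> :: "'a form2" +
  fixes L :: "('i, 'a) line_bundle" and h :: "('i, 'a) metric"
  assumes hermitian: "continuous_hermitian L h"
begin

sublocale hs: hermitian_space sec_scale "cont_sections L" "sec_inner A \<omega> L h"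
  by (rule hermitian_space_sections[OF hermitian])

abbreviation W :: "('i, 'a) bsection set" where "W \<equiv> hol_sections A L"

definition toep :: "('a \<Rightarrow> complex) \<Rightarrow> ('i, 'a) bsection \<Rightarrow> ('i, 'a) bsection" where
  "toep f s = hol_proj A \<omega> L h (fun_scale f s)"

definition toep_norm :: "(('i, 'a) bsection \<Rightarrow> ('i, 'a) bsection) \<Rightarrow> real" where
  "toep_norm T = (SUP s\<in>{s \<in> W. sec_norm A \<omega> L h s \<le> 1}. sec_norm A \<omega> L h (T s))"

lemma W_subset: "W \<subseteq> cont_sections L"
  using hermitian by (intro hol_sections_subset_cont_sections) (simp add: continuous_hermitian_def)

lemma toep_eq:
  assumes E: "hs.orthonormal E" "sec.span E = W" and f: "f \<in> smooth_fun A" and s: "s \<in> W"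
  shows "toep f s = (\<Sum>e\<in>E. sec_scale (sec_inner A \<omega> L h e (fun_scale f s)) e)"
proof -
  have "fun_scale f s \<in> cont_sections L"
    using smooth_fun_imp_continuous_on[OF f] W_subset s by (intro fun_scale_cont_sections) auto
  from hs.proj_unique[OF E(1) this] show ?thesis by (simp add: toep_def hol_proj_def E(2))
qed

lemma endo_toep:
  assumes E: "hs.orthonormal E" "sec.span E = W" and f: "f \<in> smooth_fun A"
  shows "hs.endo W (toep f)"
proof -
  note E' = hs.orthonormalD[OF E(1)]
  have fs: "fun_scale f s \<in> cont_sections L" if "s \<in> W" for s
    using smooth_fun_imp_continuous_on[OF f] W_subset that by (intro fun_scale_cont_sections) auto
  have add: "fun_scale f (s + t) = fun_scale f s + fun_scale f t" for s t :: "('i, 'a) bsection"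
    by (simp add: fun_scale_def fun_eq_iff distrib_left)
  have scale: "fun_scale f (sec_scale a s) = sec_scale a (fun_scale f s)" for a and s :: "('i, 'a) bsection"
    by (simp add: fun_scale_def sec_scale_def fun_eq_iff mult.left_commute)
  note W = subspace_hol_sections[of A L]
  show ?thesis
    unfolding hs.endo_def
  proof (intro conjI ballI allI)
    fix s t assume s: "s \<in> W" and t: "t \<in> W"
    show "toep f s \<in> W"
      unfolding toep_eq[OF E f s] using E(2) sec.span_base[of _ E]
      by (intro sec.subspace_sum[OF W] sec.subspace_scale[OF W]) auto
    have "sec_inner A \<omega> L h e (fun_scale f (s + t)) =
        sec_inner A \<omega> L h e (fun_scale f s) + sec_inner A \<omega> L h e (fun_scale f t)" if "e \<in> E" for e
      unfolding add using E'(2) that fs s t by (intro hs.ip_add) auto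
    then show "toep f (s + t) = toep f s + toep f t"
      using sec.subspace_add[OF W s t]
      by (simp add: toep_eq[OF E f] s t sec.scale_left_distrib sum.distrib)
    have "sec_inner A \<omega> L h e (fun_scale f (sec_scale a s)) =
        a * sec_inner A \<omega> L h e (fun_scale f s)" if "e \<in> E" for e a
      unfolding scale using E'(2) that fs s by (intro hs.ip_scale) auto
    then show "toep f (sec_scale a s) = sec_scale a (toep f s)" for a
      using sec.subspace_scale[OF W s]
      by (simp add: toep_eq[OF E f] s sec.scale_sum_right)
  qed
qed

text \<open>
  If \<open>W\<close> had infinite dimension, then \<^const>\<open>op_trace\<close> would be a sum over an infinite set and
  hence \<open>0\<close>, for which the trace identities are trivial; this avoids a finiteness theorem for \<open>W\<close>.
\<close>

lemma op_trace_cases: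
  obtains (infinite) "\<And>T. op_trace W T = 0"
  | (finite) E where "hs.orthonormal E" "sec.span E = W"
      "\<And>T. hs.endo W T \<Longrightarrow> op_trace W T = (\<Sum>e\<in>E. sec_inner A \<omega> L h e (T e))"
proof -
  define B where "B = (SOME B. sec.independent B \<and> sec.span B = W)"
  obtain B' where "B' \<subseteq> W" "sec.independent B'" "W \<subseteq> sec.span B'"
    by (rule sec.basis_exists)
  then have "\<exists>B. sec.independent B \<and> sec.span B = W"
    using sec.span_minimal[OF _ subspace_hol_sections] by blast
  from someI_ex[OF this] have B: "sec.independent B" "sec.span B = W" by (auto simp: B_def)
  have tr: "op_trace W T = (\<Sum>b\<in>B. sec.representation B (T b) b)" for T
    unfolding op_trace_def B_def[symmetric] Let_def ..
  show ?thesis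
  proof (cases "finite B")
    case True
    have "B \<subseteq> cont_sections L" using B(2) W_subset sec.span_superset[of B] by auto
    then obtain E where E: "hs.orthonormal E" "sec.span E = sec.span B"
      using hs.gram_schmidt[OF True] by blast
    show ?thesis
    proof (rule finite)
      show "hs.orthonormal E" "sec.span E = W" using E B by auto
      show "op_trace W T = (\<Sum>e\<in>E. sec_inner A \<omega> L h e (T e))" if "hs.endo W T" for T
        unfolding tr using hs.trace_orthonormal[OF E(1) B(1) E(2)[symmetric] True] that E B by simp
    qed
  qed (rule infinite, simp add: tr)
qed

text \<open>Projection does not change the scalar product with a holomorphic \<open>e\<close>, so
  the trace is the sum of the diagonal entries of multiplication by \<open>f\<close>, visibly
  additive in \<open>f\<close>.\<close>

lemma op_trace_toep_add:
  assumes f: "f \<in> smooth_fun A" and g: "g \<in> smooth_fun A"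
  shows "op_trace W (toep (f + g)) = op_trace W (toep f) + op_trace W (toep g)"
proof (cases rule: op_trace_cases)
  case (finite E)
  note E' = hs.orthonormalD[OF finite(1)]
  have tr: "op_trace W (toep f) = (\<Sum>e\<in>E. sec_inner A \<omega> L h e (fun_scale f e))"
    if "f \<in> smooth_fun A" for f
  proof -
    have "op_trace W (toep f) = (\<Sum>e\<in>E. sec_inner A \<omega> L h e (toep f e))"
      using finite(3)[OF endo_toep[OF finite(1,2) that]] .
    also have "\<dots> = (\<Sum>e\<in>E. sec_inner A \<omega> L h e (fun_scale f e))"
      using toep_eq[OF finite(1,2) that] sec.span_base[of _ E] finite(2)
      by (intro sum.cong) (auto simp: hs.ip_basis_combination[OF finite(1)])
    finally show ?thesis .
  qed
  have "fun_scale (f + g) s = fun_scale f s + fun_scale g s" for s :: "('i, 'a) bsection"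
    by (simp add: fun_scale_def fun_eq_iff distrib_right)
  moreover have "sec_inner A \<omega> L h e (fun_scale f e + fun_scale g e) =
      sec_inner A \<omega> L h e (fun_scale f e) + sec_inner A \<omega> L h e (fun_scale g e)" if "e \<in> E" for e
    using E'(2) that f g
    by (intro hs.ip_add fun_scale_cont_sections smooth_fun_imp_continuous_on) auto
  ultimately show ?thesis
    using tr[OF f] tr[OF g] tr[OF smooth_fun_add[OF f g]] by (simp add: sum.distrib)
next
  case infinite
  show ?thesis unfolding infinite by simp
qed

text \<open>The two products have equal traces, so only the two remainders are left. Writing the
  factor \<open>card E\<close> as a trace frees the bound from \<open>E\<close> and lets it cover
  the infinite case as well, where both sides are 0.\<close>

lemma op_trace_commutator_le:
  assumes f: "f \<in> smooth_fun A" and g: "g \<in> smooth_fun A"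
    and u: "\<And>j. j \<in> J \<Longrightarrow> u j \<in> smooth_fun A" and v: "\<And>j. j \<in> J \<Longrightarrow> v j \<in> smooth_fun A"
    and K: "toep_norm (\<lambda>s. toep f (toep g s) - (\<Sum>j\<in>J. sec_scale (a j) (toep (u j) s))) \<le> K"
    and K': "toep_norm (\<lambda>s. toep g (toep f s) - (\<Sum>j\<in>J. sec_scale (a j) (toep (v j) s))) \<le> K'"
  shows "cmod (\<Sum>j\<in>J. a j * (op_trace W (toep (u j)) - op_trace W (toep (v j)))) \<le>
    cmod (op_trace W (toep (\<lambda>_. 1))) * (K + K')"
proof (cases rule: op_trace_cases)
  case (finite E)
  note E = finite(1,2)
  note endo = endo_toep[OF E]
  let ?tr = "\<lambda>T. \<Sum>e\<in>E. sec_inner A \<omega> L h e (T e)"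
  have bound: "cmod (?tr (\<lambda>s. toep f (toep g s)) - (\<Sum>j\<in>J. a j * op_trace W (toep (u j)))) \<le> real (card E) * K"
    if f: "f \<in> smooth_fun A" and g: "g \<in> smooth_fun A" and u: "\<And>j. j \<in> J \<Longrightarrow> u j \<in> smooth_fun A"
    and K: "toep_norm (\<lambda>s. toep f (toep g s) - (\<Sum>j\<in>J. sec_scale (a j) (toep (u j) s))) \<le> K"
    for f g u K
  proof -
    have "cmod (?tr (\<lambda>s. toep f (toep g s)) - (\<Sum>j\<in>J. a j * ?tr (toep (u j)))) \<le> real (card E) *
        toep_norm (\<lambda>s. toep f (toep g s) - (\<Sum>j\<in>J. sec_scale (a j) (toep (u j) s)))"
      unfolding toep_norm_def sec_norm_def E(2)[symmetric]
    proof (rule hs.cmod_trace_diff_le[OF E(1)])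
      show "hs.endo (sec.span E) (\<lambda>s. toep f (toep g s))"
        unfolding E(2) by (rule hs.endo_comp[OF endo[OF f] endo[OF g]])
      show "hs.endo (sec.span E) (toep (u j))" if "j \<in> J" for j
        unfolding E(2) by (rule endo[OF u[OF that]])
    qed
    also have "\<dots> \<le> real (card E) * K" using K by (rule mult_left_mono) simp
    also have "(\<Sum>j\<in>J. a j * ?tr (toep (u j))) = (\<Sum>j\<in>J. a j * op_trace W (toep (u j)))"
      using finite(3)[OF endo[OF u]] by (intro sum.cong) auto
    finally show ?thesis .
  qed
  have one: "op_trace W (toep (\<lambda>_. 1)) = of_nat (card E)"
  proof -
    have "op_trace W (toep (\<lambda>_. 1)) = ?tr (toep (\<lambda>_. 1))"
      by (rule finite(3)[OF endo[OF smooth_fun_const]])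
    also have "\<dots> = (\<Sum>e\<in>E. 1)"
    proof (rule sum.cong)
      fix e assume e: "e \<in> E"
      have "e \<in> W" using e E(2) sec.span_base by blast
      from toep_eq[OF E smooth_fun_const this]
      have "sec_inner A \<omega> L h e (toep (\<lambda>_. 1) e) = sec_inner A \<omega> L h e (fun_scale (\<lambda>_. 1) e)"
        by (simp add: hs.ip_basis_combination[OF E(1) e])
      also have "\<dots> = 1" using hs.orthonormalD(3)[OF E(1) e e] by (simp add: fun_scale_def)
      finally show "sec_inner A \<omega> L h e (toep (\<lambda>_. 1) e) = 1" .
    qed simp
    finally show ?thesis by simp
  qed
  have comm: "?tr (\<lambda>s. toep f (toep g s)) = ?tr (\<lambda>s. toep g (toep f s))"
    using hs.trace_commute[OF E(1)] endo[OF f] endo[OF g] E(2) by simp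
  let ?U = "\<Sum>j\<in>J. a j * op_trace W (toep (u j))" and ?V = "\<Sum>j\<in>J. a j * op_trace W (toep (v j))"
  have "(\<Sum>j\<in>J. a j * (op_trace W (toep (u j)) - op_trace W (toep (v j)))) = ?U - ?V"
    by (simp add: right_diff_distrib sum_subtractf)
  also have "\<dots> = (?tr (\<lambda>s. toep g (toep f s)) - ?V) - (?tr (\<lambda>s. toep f (toep g s)) - ?U)"
    using comm by simp
  also have "cmod \<dots> \<le> real (card E) * K' + real (card E) * K"
    by (rule order_trans[OF norm_triangle_ineq4 add_mono[OF bound[OF g f v K'] bound[OF f g u K]]])
  finally show ?thesis by (simp add: one distrib_left add.commute)
next
  case infinite
  show ?thesis unfolding infinite by simp
qed

end

lemma continuous_hermitian_tensor_power:
  fixes A :: "('a::t2_space, 'n::finite) chart set"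
  assumes A: "complex_atlas A" and L: "holomorphic_line_bundle A L" and h: "hermitian_metric A L h"
  shows "continuous_hermitian (tensor_power L m) (metric_power h m)"
proof -
  interpret atlas A using A by (rule atlas.intro)
  have "open (patch L i)" for i using L unfolding holomorphic_line_bundle_def by blast
  then have "continuous_on (patch L i) (\<lambda>p. complex_of_real (h i p))" for i
    using h unfolding hermitian_metric_def by (blast intro: smooth_on_mfd_imp_continuous_on)
  from continuous_on_Re[OF this] have "continuous_on (patch L i) (h i)" for i by simp
  moreover have "(\<Union>i. patch L i) = UNIV" "\<And>i. open (patch L i)"
    using L unfolding holomorphic_line_bundle_def by blast+
  moreover have "h i p > 0" if "p \<in> patch L i" for i p
    using h that unfolding hermitian_metric_def by blast
  moreover have "h j p ^ m = h i p ^ m * (cmod (transition L i j p ^ m))\<^sup>2"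
    if "p \<in> patch L i \<inter> patch L j" for i j p
  proof -
    have "h j p = h i p * (cmod (transition L i j p))\<^sup>2"
      using h that unfolding hermitian_metric_def by blast
    then show ?thesis
      by (simp only: power_mult_distrib norm_power power_mult[symmetric] mult.commute[of m])
  qed
  ultimately show ?thesis
    unfolding continuous_hermitian_def tensor_power_def metric_power_def line_bundle.simps
    by (intro conjI allI ballI continuous_on_power zero_less_power) blast+
qed

section \<open>Formal traces from asymptotic expansions\<close>

text \<open>At \<open>m = 0\<close> the sides can differ (\<open>0 powi 0 = 1\<close> against
  \<open>0 / 0 = 0\<close>), so the asymptotic arguments below restrict to positive
  \<open>m\<close>.\<close>

lemma power_int_diff_of_nat:
  "m > 0 \<Longrightarrow> (of_nat m :: complex) powi (int n - int N) = of_nat m ^ n / of_nat m ^ N"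
  by (simp add: power_int_diff)

lemma bigo_cancel_power:
  fixes g :: "nat \<Rightarrow> complex"
  assumes "(\<lambda>m. of_nat m ^ n * g m) \<in> O(\<lambda>m. of_nat m powi (int n - int N))"
  shows "g \<in> O(\<lambda>m. 1 / of_nat m ^ N)"
proof -
  obtain c where c: "eventually (\<lambda>m. norm (of_nat m ^ n * g m) \<le>
      c * norm ((of_nat m :: complex) powi (int n - int N))) sequentially"
    using landau_o.bigE[OF assms] by blast
  show ?thesis
  proof (rule bigoI[where c = "\<bar>c\<bar>"])
    show "eventually (\<lambda>m. norm (g m) \<le> \<bar>c\<bar> * norm (1 / of_nat m ^ N :: complex)) sequentially"
      using c eventually_gt_at_top[of 0]
    proof eventually_elim
      case (elim m)
      have "real m ^ n * norm (g m) \<le> real m ^ n * (c / real m ^ N)"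
        using elim by (simp add: power_int_diff_of_nat norm_mult norm_divide norm_power mult_ac)
      then have "norm (g m) \<le> c / real m ^ N"
        using elim(2) by (subst (asm) mult_le_cancel_left_pos) auto
      also have "\<dots> \<le> \<bar>c\<bar> * norm (1 / of_nat m ^ N :: complex)"
        by (simp add: norm_divide norm_power divide_right_mono)
      finally show ?case .
    qed
  qed
qed

text \<open>What the asymptotic argument retains of the geometry: \<open>Tr m\<close> is to be the
  trace of the m-th Toeplitz operator, and \<open>commutator\<close> is the estimate of
  \<open>op_trace_commutator_le\<close> with both remainders merged into one constant.\<close>

locale trace_expansion =
  fixes S :: "('a \<Rightarrow> complex) set" and n :: nat
    and Tr :: "nat \<Rightarrow> ('a \<Rightarrow> complex) \<Rightarrow> complex"
    and \<tau> :: "nat \<Rightarrow> ('a \<Rightarrow> complex) \<Rightarrow> complex"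
    and C :: "'a cochains"
  assumes S_one: "(\<lambda>_. 1) \<in> S"
    and S_add: "f \<in> S \<Longrightarrow> g \<in> S \<Longrightarrow> f + g \<in> S"
    and S_C: "f \<in> S \<Longrightarrow> g \<in> S \<Longrightarrow> C j f g \<in> S"
    and Tr_add: "f \<in> S \<Longrightarrow> g \<in> S \<Longrightarrow> Tr m (f + g) = Tr m f + Tr m g"
    and expansion: "f \<in> S \<Longrightarrow> N \<ge> 1 \<Longrightarrow>
      (\<lambda>m. Tr m f - of_nat m ^ n * (\<Sum>j<N. \<tau> j f / of_nat m ^ j))
        \<in> O(\<lambda>m. of_nat m powi (int n - int N))"
    and commutator: "f \<in> S \<Longrightarrow> g \<in> S \<Longrightarrow> N \<ge> 1 \<Longrightarrow>
      \<exists>K. \<forall>m\<ge>1. cmod (\<Sum>j<N. 1 / of_nat m ^ j * (Tr m (C j f g) - Tr m (C j g f)))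
        \<le> cmod (Tr m (\<lambda>_. 1)) * (K / real m ^ N)"
begin

text \<open>The traces are additive, so the expansions of \<open>f + g\<close> and of the sum differ
  by an error term; uniqueness of expansions then identifies the coefficients. Cutting off at
  \<open>Suc j\<close> keeps the j-th one visible.\<close>

lemma \<tau>_add:
  assumes f: "f \<in> S" and g: "g \<in> S"
  shows "\<tau> j (f + g) = \<tau> j f + \<tau> j g"
proof -
  define a where "a r = \<tau> r f + \<tau> r g - \<tau> r (f + g)" for r
  let ?X = "\<lambda>f m. Tr m f - of_nat m ^ n * (\<Sum>i<Suc j. \<tau> i f / of_nat m ^ i)"
  have "(\<lambda>m. ?X (f + g) m - (?X f m + ?X g m)) \<in> O(\<lambda>m. of_nat m powi (int n - int (Suc j)))"
    by (intro sum_in_bigo expansion f g S_add) simp_all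
  also have "(\<lambda>m. ?X (f + g) m - (?X f m + ?X g m)) =
      (\<lambda>m. of_nat m ^ n * (\<Sum>i<Suc j. a i / of_nat m ^ i))"
  proof
    fix m
    have "(\<Sum>i<Suc j. a i / of_nat m ^ i) = (\<Sum>i<Suc j. \<tau> i f / of_nat m ^ i) +
        (\<Sum>i<Suc j. \<tau> i g / of_nat m ^ i) - (\<Sum>i<Suc j. \<tau> i (f + g) / of_nat m ^ i)"
      by (simp only: a_def add_divide_distrib diff_divide_distrib sum.distrib sum_subtractf)
    then show "?X (f + g) m - (?X f m + ?X g m) = of_nat m ^ n * (\<Sum>i<Suc j. a i / of_nat m ^ i)"
      by (simp only: Tr_add[OF f g]) (simp only: algebra_simps)
  qed
  finally have "(\<lambda>m. \<Sum>i<Suc j. a i / of_nat m ^ i) \<in> O(\<lambda>m. 1 / of_nat m ^ Suc j)"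
    by (rule bigo_cancel_power)
  then have "a j = 0" by (rule inverse_power_expansion_unique) simp
  then show ?thesis by (simp add: a_def)
qed

lemma \<tau>_zero:
  assumes "0 \<in> S"
  shows "\<tau> j 0 = 0"
  using \<tau>_add[OF assms assms, of j] by simp

lemma \<tau>_sum:
  assumes "finite I" "0 \<in> S" "\<And>i. i \<in> I \<Longrightarrow> f i \<in> S"
  shows "\<tau> j (sum f I) = (\<Sum>i\<in>I. \<tau> j (f i)) \<and> sum f I \<in> S"
  using assms(1,3)
  by (induction I rule: finite_induct) (auto simp: \<tau>_add S_add \<tau>_zero assms(2))

text \<open>The expansion cut off after its leading term; the error, of order \<open>n - 1\<close>,
  is absorbed.\<close>

lemma Tr_one_bound:
  obtains c where "eventually (\<lambda>m. cmod (Tr m (\<lambda>_. 1)) \<le> c * real m ^ n) sequentially"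
proof -
  obtain c where "eventually (\<lambda>m. norm (Tr m (\<lambda>_. 1) - of_nat m ^ n * (\<Sum>j<1. \<tau> j (\<lambda>_. 1) / of_nat m ^ j))
      \<le> c * norm ((of_nat m :: complex) powi (int n - int 1))) sequentially"
    using landau_o.bigE[OF expansion[OF S_one order_refl]] by blast
  then have "eventually (\<lambda>m. cmod (Tr m (\<lambda>_. 1)) \<le> (\<bar>c\<bar> + cmod (\<tau> 0 (\<lambda>_. 1))) * real m ^ n) sequentially"
    using eventually_gt_at_top[of 0]
  proof eventually_elim
    case (elim m)
    have "cmod (Tr m (\<lambda>_. 1)) \<le> cmod (Tr m (\<lambda>_. 1) - of_nat m ^ n * \<tau> 0 (\<lambda>_. 1)) +
        cmod (of_nat m ^ n * \<tau> 0 (\<lambda>_. 1))"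
      using norm_triangle_sub[of "Tr m (\<lambda>_. 1)" "of_nat m ^ n * \<tau> 0 (\<lambda>_. 1)"] by simp
    also have "cmod (Tr m (\<lambda>_. 1) - of_nat m ^ n * \<tau> 0 (\<lambda>_. 1)) \<le> c * (real m ^ n / real m)"
      using elim power_int_diff_of_nat[OF elim(2), of n 1] by (simp add: norm_divide norm_power)
    also have "\<dots> \<le> \<bar>c\<bar> * real m ^ n"
    proof (rule mult_mono)
      show "real m ^ n / real m \<le> real m ^ n"
        using elim(2) by (simp add: divide_le_eq mult_le_cancel_left1)
    qed auto
    finally show ?case by (simp add: norm_mult norm_power algebra_simps)
  qed
  then show ?thesis by (rule that)
qed

text \<open>For series without \<nu> this is the trace property in the coefficient of order
  \<open>r - n\<close>. Because of the weight \<open>1 / m^j\<close>, expanding the j-th trace to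
  \<open>N - j\<close> terms gives all errors the common order \<open>n - N\<close>; collecting
  powers of \<open>m\<close> produces the coefficients \<open>a k\<close>.\<close>

lemma \<tau>_commutator:
  assumes f: "f \<in> S" and g: "g \<in> S"
  shows "(\<Sum>j\<le>r. \<tau> (r - j) (C j f g)) = (\<Sum>j\<le>r. \<tau> (r - j) (C j g f))"
proof -
  \<comment> \<open>One order beyond \<open>r\<close>, so that \<open>a r\<close> still lies below
    the error term.\<close>
  define N where "N = Suc r"
  define D where "D j m = Tr m (C j f g) - Tr m (C j g f)" for j m
  define d where "d j i = \<tau> i (C j f g) - \<tau> i (C j g f)" for j i
  define a where "a k = (\<Sum>j\<le>k. d j (k - j))" for k
  let ?O = "O(\<lambda>m. (of_nat m :: complex) powi (int n - int N))"
  have D_exp: "(\<lambda>m. 1 / of_nat m ^ j * (D j m - of_nat m ^ n * (\<Sum>i<N - j. d j i / of_nat m ^ i))) \<in> ?O"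
    if j: "j < N" for j
  proof -
    let ?X = "\<lambda>f m. Tr m f - of_nat m ^ n * (\<Sum>i<N - j. \<tau> i f / of_nat m ^ i)"
    have "(\<lambda>m. ?X (C j f g) m - ?X (C j g f) m) \<in> O(\<lambda>m. of_nat m powi (int n - int (N - j)))"
      using j by (intro sum_in_bigo expansion S_C f g) simp_all
    also have "(\<lambda>m. ?X (C j f g) m - ?X (C j g f) m) =
        (\<lambda>m. D j m - of_nat m ^ n * (\<Sum>i<N - j. d j i / of_nat m ^ i))"
      by (rule ext) (simp add: D_def d_def diff_divide_distrib sum_subtractf right_diff_distrib)
    finally have "(\<lambda>m. 1 / of_nat m ^ j * (D j m - of_nat m ^ n * (\<Sum>i<N - j. d j i / of_nat m ^ i)))
        \<in> O(\<lambda>m. 1 / of_nat m ^ j * of_nat m powi (int n - int (N - j)))"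
      by (rule landau_o.big.mult_left)
    also have "O(\<lambda>m. 1 / of_nat m ^ j * (of_nat m :: complex) powi (int n - int (N - j))) = ?O"
    proof (rule landau_o.big.cong)
      show "eventually (\<lambda>m. 1 / of_nat m ^ j * (of_nat m :: complex) powi (int n - int (N - j)) =
          of_nat m powi (int n - int N)) sequentially"
        using eventually_gt_at_top[of 0]
      proof eventually_elim
        case (elim m)
        have "(of_nat m :: complex) ^ j * of_nat m ^ (N - j) = of_nat m ^ N"
          using j by (simp flip: power_add)
        then show ?case by (simp only: power_int_diff_of_nat[OF elim]) simp
      qed
    qed
    finally show ?thesis .
  qed
  have "(\<lambda>m. \<Sum>j<N. 1 / of_nat m ^ j * D j m) \<in> ?O"
  proof -
    obtain K where K: "\<And>m. m \<ge> 1 \<Longrightarrow> cmod (\<Sum>j<N. 1 / of_nat m ^ j * D j m)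
        \<le> cmod (Tr m (\<lambda>_. 1)) * (K / real m ^ N)"
      using commutator[OF f g, of N] unfolding D_def N_def by auto
    obtain c where c: "eventually (\<lambda>m. cmod (Tr m (\<lambda>_. 1)) \<le> c * real m ^ n) sequentially"
      by (rule Tr_one_bound)
    show ?thesis
    proof (rule bigoI[where c = "\<bar>c\<bar> * \<bar>K\<bar>"])
      show "eventually (\<lambda>m. norm (\<Sum>j<N. 1 / of_nat m ^ j * D j m) \<le>
          \<bar>c\<bar> * \<bar>K\<bar> * norm ((of_nat m :: complex) powi (int n - int N))) sequentially"
        using c eventually_gt_at_top[of 0]
      proof eventually_elim
        case (elim m)
        have "norm (\<Sum>j<N. 1 / of_nat m ^ j * D j m) \<le> cmod (Tr m (\<lambda>_. 1)) * (K / real m ^ N)"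
          using elim by (intro K) simp
        also have "\<dots> \<le> cmod (Tr m (\<lambda>_. 1)) * (\<bar>K\<bar> / real m ^ N)"
          by (intro mult_left_mono divide_right_mono) auto
        also have "\<dots> \<le> (\<bar>c\<bar> * real m ^ n) * (\<bar>K\<bar> / real m ^ N)"
        proof (rule mult_mono)
          show "cmod (Tr m (\<lambda>_. 1)) \<le> \<bar>c\<bar> * real m ^ n"
            using elim(1) by (rule order_trans) (simp add: mult_right_mono)
        qed simp_all
        finally show ?case
          using elim by (simp add: power_int_diff_of_nat norm_divide norm_power mult_ac)
      qed
    qed
  qed
  moreover have "(\<lambda>m. \<Sum>j<N. 1 / of_nat m ^ j * (D j m - of_nat m ^ n * (\<Sum>i<N - j. d j i / of_nat m ^ i))) \<in> ?O"
    by (rule big_sum_in_bigo) (rule D_exp, simp)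
  ultimately have "(\<lambda>m. (\<Sum>j<N. 1 / of_nat m ^ j * D j m) -
      (\<Sum>j<N. 1 / of_nat m ^ j * (D j m - of_nat m ^ n * (\<Sum>i<N - j. d j i / of_nat m ^ i)))) \<in> ?O"
    by (rule sum_in_bigo(2))
  also have "(\<lambda>m. (\<Sum>j<N. 1 / of_nat m ^ j * D j m) -
      (\<Sum>j<N. 1 / of_nat m ^ j * (D j m - of_nat m ^ n * (\<Sum>i<N - j. d j i / of_nat m ^ i)))) =
    (\<lambda>m. of_nat m ^ n * (\<Sum>k<N. a k / of_nat m ^ k))"
  proof
    fix m
    have "(\<Sum>j<N. 1 / of_nat m ^ j * D j m) -
      (\<Sum>j<N. 1 / of_nat m ^ j * (D j m - of_nat m ^ n * (\<Sum>i<N - j. d j i / of_nat m ^ i))) =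
      (\<Sum>j<N. \<Sum>i<N - j. of_nat m ^ n * (d j i / of_nat m ^ (j + i)))"
      unfolding sum_subtractf[symmetric]
      by (intro sum.cong) (simp_all add: right_diff_distrib sum_distrib_left power_add mult_ac)
    also have "\<dots> = (\<Sum>(j, i)\<in>{(j, i). j + i < N}. of_nat m ^ n * (d j i / of_nat m ^ (j + i)))"
      by (subst sum.Sigma) (auto intro!: sum.cong)
    also have "\<dots> = (\<Sum>k<N. \<Sum>j\<le>k. of_nat m ^ n * (d j (k - j) / of_nat m ^ (j + (k - j))))"
      by (rule sum.triangle_reindex)
    also have "\<dots> = of_nat m ^ n * (\<Sum>k<N. a k / of_nat m ^ k)"
      unfolding a_def sum_divide_distrib sum_distrib_left by (intro sum.cong) auto
    finally show "(\<Sum>j<N. 1 / of_nat m ^ j * D j m) -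
      (\<Sum>j<N. 1 / of_nat m ^ j * (D j m - of_nat m ^ n * (\<Sum>i<N - j. d j i / of_nat m ^ i))) =
      of_nat m ^ n * (\<Sum>k<N. a k / of_nat m ^ k)" .
  qed
  finally have "(\<lambda>m. \<Sum>k<N. a k / of_nat m ^ k) \<in> O(\<lambda>m. 1 / of_nat m ^ N)"
    by (rule bigo_cancel_power)
  then have "a r = 0" by (rule inverse_power_expansion_unique) (simp add: N_def)
  then show ?thesis by (simp add: a_def d_def sum_subtractf)
qed

text \<open>Sorted by the orders \<open>b\<close> and \<open>c\<close> taken from \<open>F\<close>
  and \<open>G\<close>, the inner sum over \<open>j\<close> is exactly the one in
  \<open>\<tau>_commutator\<close>, with \<open>r - (b + c)\<close> for \<open>r\<close>.\<close>

lemma coefficient_formal_trace_star: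
  assumes S0: "0 \<in> S" and F: "\<And>k. fps_nth F k \<in> S" and G: "\<And>k. fps_nth G k \<in> S"
  shows "(\<Sum>k\<le>r. \<tau> (r - k) (fps_nth (star C F G) k)) =
    (\<Sum>(b, c)\<in>{(b, c). b + c \<le> r}. \<Sum>j\<le>r - (b + c). \<tau> (r - (b + c) - j) (C j (fps_nth F b) (fps_nth G c)))"
proof -
  have fin: "finite {(j, b, c). j + b + c = k}" for k :: nat
    by (rule finite_subset[of _ "{..k} \<times> {..k} \<times> {..k}"]) auto
  have fin2: "finite {(b, c). b + c \<le> r}"
    by (rule finite_subset[of _ "{..r} \<times> {..r}"]) auto
  let ?t = "\<lambda>k (j, b, c). \<tau> (r - k) (C j (fps_nth F b) (fps_nth G c))"
  have "(\<Sum>k\<le>r. \<tau> (r - k) (fps_nth (star C F G) k)) =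
      (\<Sum>k\<le>r. \<Sum>x\<in>{(j, b, c). j + b + c = k}. ?t k x)"
  proof (rule sum.cong)
    fix k
    have "\<tau> (r - k) (fps_nth (star C F G) k) =
        (\<Sum>x\<in>{(j, b, c). j + b + c = k}. \<tau> (r - k) (case x of (j, b, c) \<Rightarrow> C j (fps_nth F b) (fps_nth G c)))"
      unfolding star_def fps_nth_Abs_fps
      using \<tau>_sum[OF fin S0, of k "\<lambda>(j, b, c). C j (fps_nth F b) (fps_nth G c)"] S_C F G by auto
    then show "\<tau> (r - k) (fps_nth (star C F G) k) = (\<Sum>x\<in>{(j, b, c). j + b + c = k}. ?t k x)"
      by (simp add: case_prod_unfold)
  qed simp
  also have "\<dots> = (\<Sum>(k, x)\<in>(SIGMA k:{..r}. {(j, b, c). j + b + c = k}). ?t k x)"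
    by (rule sum.Sigma) (auto simp: fin)
  \<comment> \<open>\<open>k\<close> is recovered as \<open>j + b + c\<close>;
    \<open>k \<le> r\<close> splits into \<open>b + c \<le> r\<close> and
    \<open>j \<le> r - (b + c)\<close>.\<close>
  also have "\<dots> = (\<Sum>(x, j)\<in>(SIGMA x:{(b, c). b + c \<le> r}. {..r - (fst x + snd x)}).
      \<tau> (r - (fst x + snd x) - j) (C j (fps_nth F (fst x)) (fps_nth G (snd x))))"
    by (rule sum.reindex_bij_witness[where i = "\<lambda>(x, j). (j + fst x + snd x, (j, fst x, snd x))"
          and j = "\<lambda>(k, (j, b, c)). ((b, c), j)"]) (auto simp: add_ac intro!: arg_cong2[where f = \<tau>])
  also have "\<dots> = (\<Sum>x\<in>{(b, c). b + c \<le> r}. \<Sum>j\<le>r - (fst x + snd x).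
      \<tau> (r - (fst x + snd x) - j) (C j (fps_nth F (fst x)) (fps_nth G (snd x))))"
    by (rule sum.Sigma[symmetric]) (auto simp: fin2)
  finally show ?thesis by (simp add: case_prod_unfold)
qed

lemma formal_trace_star_commute:
  assumes S0: "0 \<in> S" and F: "\<And>k. fps_nth F k \<in> S" and G: "\<And>k. fps_nth G k \<in> S"
  shows "formal_trace n \<tau> (star C F G) = formal_trace n \<tau> (star C G F)"
proof -
  have "(\<Sum>k\<le>r. \<tau> (r - k) (fps_nth (star C F G) k)) =
      (\<Sum>k\<le>r. \<tau> (r - k) (fps_nth (star C G F) k))" for r
  proof -
    have "(\<Sum>(b, c)\<in>{(b, c). b + c \<le> r}. \<Sum>j\<le>r - (b + c). \<tau> (r - (b + c) - j) (C j (fps_nth F b) (fps_nth G c))) =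
        (\<Sum>(b, c)\<in>{(b, c). b + c \<le> r}. \<Sum>j\<le>r - (b + c). \<tau> (r - (b + c) - j) (C j (fps_nth G c) (fps_nth F b)))"
      by (simp only: \<tau>_commutator[OF F G])
    \<comment> \<open>The range \<open>b + c \<le> r\<close> is symmetric, so the names of
      \<open>b\<close> and \<open>c\<close> may be exchanged.\<close>
    also have "\<dots> = (\<Sum>(b, c)\<in>{(b, c). b + c \<le> r}. \<Sum>j\<le>r - (b + c).
        \<tau> (r - (b + c) - j) (C j (fps_nth G b) (fps_nth F c)))"
      by (rule sum.reindex_bij_witness[where i = prod.swap and j = prod.swap]) (auto simp: add.commute)
    finally show ?thesis
      unfolding coefficient_formal_trace_star[OF S0 F G] coefficient_formal_trace_star[OF S0 G F] .
  qed
  then show ?thesis by (simp add: formal_trace_def)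
qed

end

section \<open>The trace property\<close>

theorem proposition5p5:
  fixes A :: "('a::t2_space, 'n::finite) chart set"
    and \<omega> :: "'a form2"
    and L :: "('i, 'a) line_bundle"
    and h :: "('i, 'a) metric"
    and nab :: "('i, 'a) conn"
    and C :: "'a cochains"
    and \<tau> :: "nat \<Rightarrow> ('a \<Rightarrow> complex) \<Rightarrow> complex"
    and F G :: "('a \<Rightarrow> complex) fps"
  assumes "compact (UNIV :: 'a set)"
    and "complex_atlas A"
    and "kaehler_form A \<omega>"
    and "quantum_line_bundle A \<omega> L h nab"
    and "very_ample A L"
    and "berezin_toeplitz_star_product A \<omega> L h C"
    and "trace_coefficients A \<omega> L h \<tau>"
    and "F \<in> smooth_series A"
    and "G \<in> smooth_series A"
  shows "formal_trace CARD('n) \<tau> (star C F G) = formal_trace CARD('n) \<tau> (star C G F)"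
proof -
  have compact: "compact (UNIV :: 'a set)" and A: "complex_atlas A" and \<omega>: "kaehler_form A \<omega>"
    and C: "berezin_toeplitz_star_product A \<omega> L h C" and \<tau>: "trace_coefficients A \<omega> L h \<tau>"
    using assms by blast+
  interpret compact_kaehler A \<omega>
    using A compact \<omega> by unfold_locales
  have L: "holomorphic_line_bundle A L" "hermitian_metric A L h"
    using assms(4) unfolding quantum_line_bundle_def by blast+
  have herm_bundle: "hermitian_bundle A \<omega> (tensor_power L m) (metric_power h m)" for m
    using continuous_hermitian_tensor_power[OF A L] compact_kaehler_axioms
    by (simp add: hermitian_bundle_def hermitian_bundle_axioms_def)
  have toep: "hermitian_bundle.toep A \<omega> (tensor_power L m) (metric_power h m) f = toeplitz A \<omega> L h m f"
    for m f
    by (rule ext) (simp add: hermitian_bundle.toep_def[OF herm_bundle] toeplitz_def)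
  have toep_norm: "hermitian_bundle.toep_norm A \<omega> (tensor_power L m) (metric_power h m) T =
      op_norm A \<omega> L h m T" for m T
    by (simp add: hermitian_bundle.toep_norm_def[OF herm_bundle] op_norm_def)
  have C_smooth: "C j f g \<in> smooth_fun A" if "f \<in> smooth_fun A" "g \<in> smooth_fun A" for j f g
    using C that unfolding berezin_toeplitz_star_product_def star_product_def by blast
  let ?Tr = "\<lambda>m f. op_trace (hol_sections A (tensor_power L m)) (toeplitz A \<omega> L h m f)"
  let ?D = "\<lambda>f g N m s. toeplitz A \<omega> L h m f (toeplitz A \<omega> L h m g s)
    - (\<Sum>j<N. sec_scale (1 / of_nat m ^ j) (toeplitz A \<omega> L h m (C j f g) s))"
  have star: "\<exists>K. \<forall>m\<ge>1. op_norm A \<omega> L h m (?D f g N m) \<le> K / real m ^ N"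
    if "f \<in> smooth_fun A" "g \<in> smooth_fun A" "N \<ge> 1" for f g N
    using C that unfolding berezin_toeplitz_star_product_def by blast
  interpret trace_expansion "smooth_fun A" "CARD('n)" ?Tr \<tau> C
  proof
    show "?Tr m (f + g) = ?Tr m f + ?Tr m g" if "f \<in> smooth_fun A" "g \<in> smooth_fun A" for m f g
      using hermitian_bundle.op_trace_toep_add[OF herm_bundle that] by (simp only: toep)
    show "(\<lambda>m. ?Tr m f - of_nat m ^ CARD('n) * (\<Sum>j<N. \<tau> j f / of_nat m ^ j))
        \<in> O(\<lambda>m. of_nat m powi (int CARD('n) - int N))" if "f \<in> smooth_fun A" "N \<ge> 1" for f N
      using \<tau> that unfolding trace_coefficients_def by blast
    show "\<exists>K. \<forall>m\<ge>1. cmod (\<Sum>j<N. 1 / of_nat m ^ j * (?Tr m (C j f g) - ?Tr m (C j g f)))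
        \<le> cmod (?Tr m (\<lambda>_. 1)) * (K / real m ^ N)"
      if f: "f \<in> smooth_fun A" and g: "g \<in> smooth_fun A" and N: "N \<ge> 1" for f g N
    proof -
      obtain K where K: "\<And>m. m \<ge> 1 \<Longrightarrow> op_norm A \<omega> L h m (?D f g N m) \<le> K / real m ^ N"
        using star[OF f g N] by blast
      obtain K' where K': "\<And>m. m \<ge> 1 \<Longrightarrow> op_norm A \<omega> L h m (?D g f N m) \<le> K' / real m ^ N"
        using star[OF g f N] by blast
      \<comment> \<open>The two orders of the product contribute one constant each, and neither
        constant depends on \<open>m\<close>.\<close>
      have "cmod (\<Sum>j<N. 1 / of_nat m ^ j * (?Tr m (C j f g) - ?Tr m (C j g f)))
          \<le> cmod (?Tr m (\<lambda>_. 1)) * ((K + K') / real m ^ N)" if m: "m \<ge> 1" for m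
        using hermitian_bundle.op_trace_commutator_le[OF herm_bundle f g C_smooth[OF f g] C_smooth[OF g f],
            unfolded toep toep_norm, OF K[OF m] K'[OF m]]
        by (simp only: add_divide_distrib)
      then show ?thesis by blast
    qed
  qed (simp_all add: smooth_fun_const smooth_fun_add C_smooth)
  have "0 \<in> smooth_fun A" using smooth_fun_const[of 0] by (simp add: zero_fun_def)
  then show ?thesis
    using assms(8,9) by (intro formal_trace_star_commute) (simp_all add: smooth_series_def)
qed

end
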